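(* Let $S_n$ denote the symmetric group on $n$ letters. Then (i) $\pi_3(SK(S_n,1))\cong\mathbb{Z}_2\times\mathbb{Z}_2$ when $n\ge4$, and $\pi_3(SK(S_n,1))\cong\mathbb{Z}_2$ otherwise; (ii) $\pi_2^S(K(S_n,1))\cong\mathbb{Z}_2\times\mathbb{Z}_2$ when $n\ge4$, and $\pi_2^S(K(S_n,1))\cong\mathbb{Z}_2$ otherwise.
   Context: $\mathbb{Z}_2$ is the cyclic group of order $2$. For a group $G$, $K(G,1)$ is the Eilenberg–MacLane space, $SX$ denotes the suspension of a space $X$, and $\pi_2^S(K(G,1))=\pi_4(S^2K(G,1))$ is the second stable homotopy group of $K(G,1)$. Algebraically (Brown–Loday): let $G\otimes G$ be the nonabelian tensor square, i.e. the group generated by symbols $g\otimes h$ ($g,h\in G$) with relations $gg'\otimes h=({}^gg'\otimes{}^gh)(g\otimes h)$ and $g\otimes hh'=(g\otimes h)({}^hg\otimes{}^hh')$ for all $g,g',h,h'\in G$, where ${}^xy=xyx^{-1}$; let $J(G)$ be the kernel of the homomorphism from $G\otimes G$ to the commutator subgroup of $G$ sending $g\otimes h$ to $[g,h]=ghg^{-1}h^{-1}$, and let $\Delta(G)$ be the subgroup of $J(G)$ generated by all $(x\otimes y)(y\otimes x)$ with $x,y\in G$. Then $\pi_3(SK(G,1))\cong J(G)$ and $\pi_2^S(K(G,1))\cong J(G)/\Delta(G)$.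
   Formalization: "Otherwise" is read as n = 2, 3: for n ≤ 1 the group S_n is trivial, so both homotopy groups are trivial and not Z_2. The Brown–Loday isomorphisms with J(G) and J(G)/Δ(G) are taken as a hypothesis, as the known result quoted. *)

theory Defs
  imports "HOL-Homology.Homology" "HOL-Algebra.Sym_Groups" "HOL-Algebra.Elementary_Groups"
begin

section \<open>Homotopy groups\<close>

definition cube :: "nat \<Rightarrow> (nat \<Rightarrow> real) topology" where
  "cube n = subtopology (Euclidean_space n) {x. \<forall>i<n. 0 \<le> x i \<and> x i \<le> 1}"

definition cube_boundary :: "nat \<Rightarrow> (nat \<Rightarrow> real) set" where
  "cube_boundary n = {x \<in> topspace (cube n). \<exists>i<n. x i = 0 \<or> x i = 1}"

definition spheroid :: "nat \<Rightarrow> 'a topology \<Rightarrow> 'a \<Rightarrow> ((nat \<Rightarrow> real) \<Rightarrow> 'a) \<Rightarrow> bool" where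
  "spheroid n X x0 f \<longleftrightarrow> continuous_map (cube n) X f \<and> (\<forall>x\<in>cube_boundary n. f x = x0)"

abbreviation spheroid_homotopic ::
  "nat \<Rightarrow> 'a topology \<Rightarrow> 'a \<Rightarrow> ((nat \<Rightarrow> real) \<Rightarrow> 'a) \<Rightarrow> ((nat \<Rightarrow> real) \<Rightarrow> 'a) \<Rightarrow> bool" where
  "spheroid_homotopic n X x0 \<equiv>
     homotopic_with (\<lambda>h. \<forall>x\<in>cube_boundary n. h x = x0) (cube n) X"

definition spheroid_concat ::
  "((nat \<Rightarrow> real) \<Rightarrow> 'a) \<Rightarrow> ((nat \<Rightarrow> real) \<Rightarrow> 'a) \<Rightarrow> (nat \<Rightarrow> real) \<Rightarrow> 'a" where
  "spheroid_concat f g x =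
     (if x 0 \<le> 1/2 then f (x(0 := 2 * x 0)) else g (x(0 := 2 * x 0 - 1)))"

text \<open>Meaningful for \<open>n \<ge> 1\<close>. The product of two classes is the class of the
  concatenation (in the coordinate with index 0) of any two representatives.\<close>

definition homotopy_group ::
  "nat \<Rightarrow> 'a topology \<Rightarrow> 'a \<Rightarrow> ((nat \<Rightarrow> real) \<Rightarrow> 'a) set monoid" where
  "homotopy_group n X x0 =
     \<lparr> carrier = {{g. spheroid_homotopic n X x0 f g} | f. spheroid n X x0 f},
       monoid.mult = (\<lambda>A B. {h. \<exists>f\<in>A. \<exists>g\<in>B. spheroid_homotopic n X x0 (spheroid_concat f g) h}),
       one = {g. spheroid_homotopic n X x0 (\<lambda>_. x0) g} \<rparr>"

section \<open>Suspensions\<close>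

definition quotient_topology :: "'a topology \<Rightarrow> ('a \<Rightarrow> 'b) \<Rightarrow> 'b topology" where
  "quotient_topology X q =
     topology (\<lambda>U. U \<subseteq> q ` topspace X \<and> openin X {x \<in> topspace X. q x \<in> U})"

lemma openin_quotient_topology:
  "openin (quotient_topology X q) U \<longleftrightarrow>
     U \<subseteq> q ` topspace X \<and> openin X {x \<in> topspace X. q x \<in> U}"
proof -
  let ?P = "\<lambda>U. U \<subseteq> q ` topspace X \<and> openin X {x \<in> topspace X. q x \<in> U}"
  have "istopology ?P"
    unfolding istopology_def
  proof (intro conjI allI impI)
    fix S T assume "?P S" "?P T"
    moreover have "{x \<in> topspace X. q x \<in> S \<inter> T} =
        {x \<in> topspace X. q x \<in> S} \<inter> {x \<in> topspace X. q x \<in> T}" by auto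
    ultimately show "S \<inter> T \<subseteq> q ` topspace X" "openin X {x \<in> topspace X. q x \<in> S \<inter> T}"
      by auto
  next
    fix \<K> assume K: "\<forall>K\<in>\<K>. ?P K"
    then show "\<Union>\<K> \<subseteq> q ` topspace X" by blast
    have "{x \<in> topspace X. q x \<in> \<Union>\<K>} = (\<Union>K\<in>\<K>. {x \<in> topspace X. q x \<in> K})" by auto
    then show "openin X {x \<in> topspace X. q x \<in> \<Union>\<K>}" using K by auto
  qed
  then show ?thesis by (simp add: quotient_topology_def)
qed

lemma quotient_map_quotient_topology: "quotient_map X (quotient_topology X q) q"
proof -
  have "openin (quotient_topology X q) (q ` topspace X)"
    by (auto simp: openin_quotient_topology intro: back_subst[where P = "openin X", OF openin_topspace])
  then have "topspace (quotient_topology X q) = q ` topspace X"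
    by (metis openin_quotient_topology openin_subset openin_topspace subset_antisym)
  then show ?thesis by (auto simp: quotient_map_def openin_quotient_topology)
qed

text \<open>The unreduced suspension: in \<open>X \<times> [0,1]\<close> the two ends \<open>X \<times> {0}\<close> and \<open>X \<times> {1}\<close>
  are collapsed to one point each. Points are the classes of this identification. For CW
  complexes this has the same homotopy type as the reduced suspension.\<close>

definition suspension_class :: "'a topology \<Rightarrow> 'a \<times> real \<Rightarrow> ('a \<times> real) set" where
  "suspension_class X p =
     (if snd p = 0 then topspace X \<times> {0}
      else if snd p = 1 then topspace X \<times> {1}
      else {p})"

definition suspension :: "'a topology \<Rightarrow> ('a \<times> real) set topology" where
  "suspension X =
     quotient_topology (prod_topology X (top_of_set {0..1})) (suspension_class X)"

definition suspension_pole :: "'a topology \<Rightarrow> ('a \<times> real) set" where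
  "suspension_pole X = topspace X \<times> {0}"

definition pi3_suspension :: "'a topology \<Rightarrow> ((nat \<Rightarrow> real) \<Rightarrow> ('a \<times> real) set) set monoid" where
  "pi3_suspension X = homotopy_group 3 (suspension X) (suspension_pole X)"

definition stable_pi2 ::
  "'a topology \<Rightarrow> ((nat \<Rightarrow> real) \<Rightarrow> (('a \<times> real) set \<times> real) set) set monoid" where
  "stable_pi2 X =
     homotopy_group 4 (suspension (suspension X)) (suspension_pole (suspension X))"

section \<open>CW complexes and Eilenberg--MacLane spaces\<close>

definition closed_disk :: "nat \<Rightarrow> (nat \<Rightarrow> real) topology" where
  "closed_disk k = subtopology (Euclidean_space k) {x. (\<Sum>i<k. (x i)\<^sup>2) \<le> 1}"

definition open_disk :: "nat \<Rightarrow> (nat \<Rightarrow> real) topology" where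
  "open_disk k = subtopology (Euclidean_space k) {x. (\<Sum>i<k. (x i)\<^sup>2) < 1}"

text \<open>A CW structure is given by its characteristic maps: a member \<open>(k, \<phi>)\<close> of \<open>\<Phi>\<close> is a
  \<open>k\<close>-cell with characteristic map \<open>\<phi>\<close>. The last two conditions are closure-finiteness and
  the weak topology.\<close>

definition CW_structure :: "'a topology \<Rightarrow> (nat \<times> ((nat \<Rightarrow> real) \<Rightarrow> 'a)) set \<Rightarrow> bool" where
  "CW_structure X \<Phi> \<longleftrightarrow>
     Hausdorff_space X \<and>
     (\<forall>(k, \<phi>)\<in>\<Phi>. continuous_map (closed_disk k) X \<phi> \<and> embedding_map (open_disk k) X \<phi>) \<and>
     pairwise (\<lambda>(k, \<phi>) (l, \<psi>).
       disjnt (\<phi> ` topspace (open_disk k)) (\<psi> ` topspace (open_disk l))) \<Phi> \<and>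
     (\<Union>(k, \<phi>)\<in>\<Phi>. \<phi> ` topspace (open_disk k)) = topspace X \<and>
     (\<forall>(k, \<phi>)\<in>\<Phi>. \<exists>\<Psi>\<subseteq>\<Phi>. finite \<Psi> \<and> (\<forall>(l, \<psi>)\<in>\<Psi>. l < k) \<and>
       \<phi> ` (topspace (closed_disk k) - topspace (open_disk k))
         \<subseteq> (\<Union>(l, \<psi>)\<in>\<Psi>. \<psi> ` topspace (open_disk l))) \<and>
     (\<forall>C\<subseteq>topspace X. closedin X C \<longleftrightarrow>
       (\<forall>(k, \<phi>)\<in>\<Phi>. closedin (closed_disk k) {x \<in> topspace (closed_disk k). \<phi> x \<in> C}))"

definition CW_complex :: "'a topology \<Rightarrow> bool" where
  "CW_complex X \<longleftrightarrow> (\<exists>\<Phi>. CW_structure X \<Phi>)"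

definition is_K_G_1 :: "'g monoid \<Rightarrow> 'a topology \<Rightarrow> 'a \<Rightarrow> bool" where
  "is_K_G_1 G X x0 \<longleftrightarrow>
     CW_complex X \<and> path_connected_space X \<and> x0 \<in> topspace X \<and>
     homotopy_group 1 X x0 \<cong> G \<and>
     (\<forall>k\<ge>2. trivial_group (homotopy_group k X x0))"

section \<open>Groups given by generators and relations\<close>

text \<open>A letter \<open>(True, s)\<close> stands for \<open>s\<close> and \<open>(False, s)\<close> for its inverse; a pair
  \<open>(u, v)\<close> in \<open>R\<close> is the relation \<open>u = v\<close>.\<close>

type_synonym 's word = "(bool \<times> 's) list"

inductive word_eq :: "'s set \<Rightarrow> ('s word \<times> 's word) set \<Rightarrow> 's word \<Rightarrow> 's word \<Rightarrow> bool"
  for S R where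
  refl: "w \<in> lists (UNIV \<times> S) \<Longrightarrow> word_eq S R w w"
| sym: "word_eq S R u v \<Longrightarrow> word_eq S R v u"
| trans: "word_eq S R u v \<Longrightarrow> word_eq S R v w \<Longrightarrow> word_eq S R u w"
| append: "word_eq S R u u' \<Longrightarrow> word_eq S R v v' \<Longrightarrow> word_eq S R (u @ v) (u' @ v')"
| cancel: "s \<in> S \<Longrightarrow> word_eq S R [(b, s), (\<not> b, s)] []"
| relation: "(u, v) \<in> R \<Longrightarrow> u \<in> lists (UNIV \<times> S) \<Longrightarrow> v \<in> lists (UNIV \<times> S) \<Longrightarrow> word_eq S R u v"

definition presented_group :: "'s set \<Rightarrow> ('s word \<times> 's word) set \<Rightarrow> 's word set monoid" where
  "presented_group S R =
     \<lparr> carrier = {{v. word_eq S R u v} | u. u \<in> lists (UNIV \<times> S)},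
       monoid.mult = (\<lambda>A B. {w. \<exists>u\<in>A. \<exists>v\<in>B. word_eq S R (u @ v) w}),
       one = {w. word_eq S R [] w} \<rparr>"

section \<open>The nonabelian tensor square\<close>

context
  fixes G :: "'g monoid" (structure)
begin

definition conj_by :: "'g \<Rightarrow> 'g \<Rightarrow> 'g" where
  "conj_by x y = x \<otimes> y \<otimes> inv x"

definition comm :: "'g \<Rightarrow> 'g \<Rightarrow> 'g" where
  "comm g h = g \<otimes> h \<otimes> inv g \<otimes> inv h"

definition tensor_relations :: "(('g \<times> 'g) word \<times> ('g \<times> 'g) word) set" where
  "tensor_relations =
     {([(True, (g \<otimes> g', h))], [(True, (conj_by g g', conj_by g h)), (True, (g, h))])
        | g g' h. g \<in> carrier G \<and> g' \<in> carrier G \<and> h \<in> carrier G} \<union>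
     {([(True, (g, h \<otimes> h'))], [(True, (g, h)), (True, (conj_by h g, conj_by h h'))])
        | g h h'. g \<in> carrier G \<and> h \<in> carrier G \<and> h' \<in> carrier G}"

definition tensor_square :: "('g \<times> 'g) word set monoid" where
  "tensor_square = presented_group (carrier G \<times> carrier G) tensor_relations"

definition tensor :: "'g \<Rightarrow> 'g \<Rightarrow> ('g \<times> 'g) word set" where
  "tensor g h = {w. word_eq (carrier G \<times> carrier G) tensor_relations [(True, (g, h))] w}"

definition word_commutator :: "('g \<times> 'g) word \<Rightarrow> 'g" where
  "word_commutator w =
     foldr (\<lambda>(b, (g, h)) r. (if b then comm g h else inv (comm g h)) \<otimes> r) w \<one>"

text \<open>The homomorphism determined by \<open>g \<otimes> h \<mapsto> [g, h]\<close>;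
  all words in a class have the same value.\<close>

definition commutator_map :: "('g \<times> 'g) word set \<Rightarrow> 'g" where
  "commutator_map A = the_elem (word_commutator ` A)"

definition J_group :: "('g \<times> 'g) word set monoid" where
  "J_group = tensor_square
     \<lparr>carrier := kernel tensor_square (G\<lparr>carrier := derived G (carrier G)\<rparr>) commutator_map\<rparr>"

definition Delta_subgroup :: "('g \<times> 'g) word set set" where
  "Delta_subgroup = generate J_group
     {tensor x y \<otimes>\<^bsub>tensor_square\<^esub> tensor y x | x y. x \<in> carrier G \<and> y \<in> carrier G}"

end

text \<open>The Brown--Loday isomorphisms, for all groups with elements of type \<open>'g\<close> and all
  Eilenberg--MacLane spaces with points of type \<open>'a\<close>.\<close>

definition Brown_Loday :: "'g itself \<Rightarrow> 'a itself \<Rightarrow> bool" where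
  "Brown_Loday _ _ \<longleftrightarrow>
     (\<forall>(G :: 'g monoid) (X :: 'a topology) x0. group G \<and> is_K_G_1 G X x0 \<longrightarrow>
        pi3_suspension X \<cong> J_group G \<and>
        stable_pi2 X \<cong> J_group G Mod Delta_subgroup G)"

end

theory Submission
  imports Defs
begin

text \<open>
  Let \<open>T\<close> be the tensor square of \<open>S\<^sub>n\<close>, \<open>\<partial>\<close> its map to \<open>S\<^sub>n\<close> and \<open>s = (1 2)\<close>. The elements
  \<open>\<alpha> = s \<otimes> s\<close> and, for \<open>n \<ge> 4\<close>, \<open>\<beta> = (3 4) \<otimes> s\<close> of \<open>J(S\<^sub>n)\<close> are central, of order at most 2
  and fixed by \<open>S\<^sub>n\<close>; let \<open>M\<close> be the subgroup that they generate.

  Upper bound: in the semidirect product of \<open>T\<close> and \<open>S\<^sub>n\<close> the elements \<open>(g \<otimes> s, s)\<close> are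
  involutions lying over the transpositions \<open>gsg\<inverse>\<close>. Modulo \<open>M\<close> they depend only on that
  transposition and are permuted by conjugation as the transpositions are. Hence modulo \<open>M\<close> a
  product of them is determined by its image in \<open>S\<^sub>n\<close>. As \<open>T\<close> is generated by the
  \<open>g \<otimes> s\<close>, this gives \<open>J(S\<^sub>n) = M\<close>.

  Lower bound: the pairing \<open>g, h \<mapsto> sgn g \<sqdot> sgn h\<close> with values in \<open>\<int>/2\<close> detects \<open>\<alpha>\<close>, and the
  commutator pairing of a central extension of \<open>S\<^sub>n\<close> in which disjoint transpositions lift to
  anticommuting elements kills \<open>\<alpha>\<close> and detects \<open>\<beta>\<close>. Both pairings are trivial on
  \<open>(x \<otimes> y)(y \<otimes> x)\<close>, so \<open>\<Delta>(S\<^sub>n)\<close> is trivial.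
\<close>

section \<open>Presented groups\<close>

declare in_listsD [rule del] in_listsI [rule del]

lemma (in group) inv_mult_cancel_left:
  "x \<in> carrier G \<Longrightarrow> y \<in> carrier G \<Longrightarrow> inv x \<otimes> (x \<otimes> y) = y"
  by (simp flip: m_assoc)

lemma (in group) mult_inv_cancel_left:
  "x \<in> carrier G \<Longrightarrow> y \<in> carrier G \<Longrightarrow> x \<otimes> (inv x \<otimes> y) = y"
  by (simp flip: m_assoc)

lemmas (in group) word_simps =
  m_assoc inv_mult_group inv_mult_cancel_left mult_inv_cancel_left

lemma word_eq_imp_lists:
  "word_eq S R u v \<Longrightarrow> u \<in> lists (UNIV \<times> S) \<and> v \<in> lists (UNIV \<times> S)"
  by (induction rule: word_eq.induct) auto

definition word_class :: "'s set \<Rightarrow> ('s word \<times> 's word) set \<Rightarrow> 's word \<Rightarrow> 's word set" where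
  "word_class S R u = {v. word_eq S R u v}"

lemma word_class_eq: "word_eq S R u v \<Longrightarrow> word_class S R u = word_class S R v"
  unfolding word_class_def by (blast intro: word_eq.sym word_eq.trans)

lemma carrier_presented_group:
  "carrier (presented_group S R) = word_class S R ` lists (UNIV \<times> S)"
  unfolding presented_group_def word_class_def by auto

lemma one_presented_group: "\<one>\<^bsub>presented_group S R\<^esub> = word_class S R []"
  unfolding presented_group_def word_class_def by simp

lemma mult_presented_group:
  assumes "u \<in> lists (UNIV \<times> S)" "v \<in> lists (UNIV \<times> S)"
  shows "word_class S R u \<otimes>\<^bsub>presented_group S R\<^esub> word_class S R v = word_class S R (u @ v)"
  using assms unfolding presented_group_def word_class_def
  by (auto intro: word_eq.refl word_eq.append word_eq.trans)

text \<open>\<open>rev (map (apfst Not) u)\<close> is the formal inverse of \<open>u\<close>. The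
  two letters that meet at the junction cancel first, and the induction hypothesis removes the
  rest.\<close>

lemma word_eq_inverse_letters:
  assumes "u \<in> lists (UNIV \<times> S)"
  shows "word_eq S R (rev (map (apfst Not) u) @ u) []"
  using assms
proof (induction u)
  case Nil
  then show ?case by (simp add: word_eq.refl)
next
  case (Cons l u)
  obtain b s where l: "l = (b, s)" by (cases l)
  let ?r = "rev (map (apfst Not) u)"
  have s: "s \<in> S" and u: "u \<in> lists (UNIV \<times> S)"
    using Cons l by auto
  have r: "?r \<in> lists (UNIV \<times> S)"
    using u by (force simp: in_lists_conv_set)
  have "word_eq S R ((?r @ [(\<not> b, s), (b, s)]) @ u) ((?r @ []) @ u)"
    using word_eq.cancel[OF s, of R "\<not> b"] r u by (intro word_eq.append word_eq.refl) simp_all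
  then show ?case
    using Cons.IH u l by (auto intro: word_eq.trans)
qed

lemma group_presented_group: "group (presented_group S R)"
proof (rule groupI)
  fix x assume "x \<in> carrier (presented_group S R)"
  then obtain u where u: "u \<in> lists (UNIV \<times> S)" "x = word_class S R u"
    by (auto simp: carrier_presented_group)
  have "rev (map (apfst Not) u) \<in> lists (UNIV \<times> S)"
    using u(1) by (force simp: in_lists_conv_set)
  then show "\<exists>y\<in>carrier (presented_group S R). y \<otimes>\<^bsub>presented_group S R\<^esub> x = \<one>\<^bsub>presented_group S R\<^esub>"
    using word_class_eq[OF word_eq_inverse_letters[OF u(1)]] u
    by (auto simp: carrier_presented_group one_presented_group mult_presented_group intro!: bexI)
qed (auto simp: carrier_presented_group one_presented_group mult_presented_group
    append_in_lists_conv)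

text \<open>The fold of \<open>word_commutator\<close> for an arbitrary assignment \<open>f\<close>
  of the generators, so that \<open>commutator_map\<close> becomes an instance of
  \<open>presented_lift\<close>.\<close>

definition word_value :: "('h, 'm) monoid_scheme \<Rightarrow> ('s \<Rightarrow> 'h) \<Rightarrow> 's word \<Rightarrow> 'h" where
  "word_value H f w = foldr (\<lambda>(b, s) r. (if b then f s else inv\<^bsub>H\<^esub> f s) \<otimes>\<^bsub>H\<^esub> r) w \<one>\<^bsub>H\<^esub>"

definition presented_lift :: "('h, 'm) monoid_scheme \<Rightarrow> ('s \<Rightarrow> 'h) \<Rightarrow> 's word set \<Rightarrow> 'h" where
  "presented_lift H f A = the_elem (word_value H f ` A)"

context group
begin

lemma word_value_closed:
  assumes "f \<in> S \<rightarrow> carrier G" "w \<in> lists (UNIV \<times> S)"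
  shows "word_value G f w \<in> carrier G"
  using assms(2) by (induction w) (use assms(1) in \<open>auto simp: word_value_def Pi_iff\<close>)

lemma word_value_append:
  assumes "f \<in> S \<rightarrow> carrier G" "u \<in> lists (UNIV \<times> S)" "v \<in> lists (UNIV \<times> S)"
  shows "word_value G f (u @ v) = word_value G f u \<otimes> word_value G f v"
  using assms(2)
proof (induction u)
  case Nil
  then show ?case using word_value_closed[OF assms(1,3)] by (simp add: word_value_def)
next
  case (Cons l u)
  then show ?case
    using word_value_closed[OF assms(1,3)] word_value_closed[OF assms(1), of u] assms(1)
    by (auto simp: word_value_def m_assoc Pi_iff)
qed

lemma word_value_eq:
  assumes f: "f \<in> S \<rightarrow> carrier G"
    and R: "\<And>u v. (u, v) \<in> R \<Longrightarrow> word_value G f u = word_value G f v"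
    and "word_eq S R u v"
  shows "word_value G f u = word_value G f v"
  using assms(3)
proof (induction rule: word_eq.induct)
  case (append u u' v v')
  then show ?case
    by (auto simp: word_value_append[OF f] dest!: word_eq_imp_lists)
next
  case (cancel s b)
  then show ?case using f by (auto simp: word_value_def Pi_iff)
qed (use R in auto)

text \<open>The universal property of a presentation. All words in a class have the same value, so
  the image of a class is a singleton and \<open>the_elem\<close> returns that value.\<close>

lemma
  assumes f: "f \<in> S \<rightarrow> carrier G"
    and R: "\<And>u v. (u, v) \<in> R \<Longrightarrow> word_value G f u = word_value G f v"
  shows presented_lift_class:
      "u \<in> lists (UNIV \<times> S) \<Longrightarrow> presented_lift G f (word_class S R u) = word_value G f u"
    and presented_lift_hom: "presented_lift G f \<in> hom (presented_group S R) G"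
proof -
  show cls: "presented_lift G f (word_class S R u) = word_value G f u"
    if u: "u \<in> lists (UNIV \<times> S)" for u
  proof -
    have "word_value G f v = word_value G f u" if "v \<in> word_class S R u" for v
      using word_value_eq[OF f R] that by (simp add: word_class_def)
    moreover have "u \<in> word_class S R u"
      using word_eq.refl[OF u] by (simp add: word_class_def)
    ultimately have "word_value G f ` word_class S R u = {word_value G f u}"
      by blast
    then show ?thesis by (simp add: presented_lift_def)
  qed
  show "presented_lift G f \<in> hom (presented_group S R) G"
    by (rule homI)
      (auto simp: carrier_presented_group cls mult_presented_group word_value_closed[OF f]
        word_value_append[OF f] append_in_lists_conv)
qed

end

text \<open>By \<open>cancel\<close> a negative letter is the inverse of a positive one, so closure
  under inverses and products reaches every word.\<close>

lemma presented_group_induct [consumes 1, case_names one gen inv mult]: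
  assumes x: "x \<in> carrier (presented_group S R)"
    and one: "P \<one>\<^bsub>presented_group S R\<^esub>"
    and gen: "\<And>s. s \<in> S \<Longrightarrow> P (word_class S R [(True, s)])"
    and inv: "\<And>x. x \<in> carrier (presented_group S R) \<Longrightarrow> P x \<Longrightarrow> P (inv\<^bsub>presented_group S R\<^esub> x)"
    and mult: "\<And>x y. x \<in> carrier (presented_group S R) \<Longrightarrow> y \<in> carrier (presented_group S R) \<Longrightarrow>
      P x \<Longrightarrow> P y \<Longrightarrow> P (x \<otimes>\<^bsub>presented_group S R\<^esub> y)"
  shows "P x"
proof -
  interpret PG: group "presented_group S R" by (rule group_presented_group)
  have neg: "word_class S R [(False, s)] = inv\<^bsub>presented_group S R\<^esub> word_class S R [(True, s)]"
    if s: "s \<in> S" for s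
    using word_class_eq[OF word_eq.cancel[OF s, of R False]] s
    by (intro PG.inv_equality[symmetric])
      (auto simp: mult_presented_group one_presented_group carrier_presented_group)
  have "P (word_class S R u)" if "u \<in> lists (UNIV \<times> S)" for u
    using that
  proof (induction u)
    case Nil
    then show ?case using one by (simp add: one_presented_group)
  next
    case (Cons l u)
    obtain b s where l: "l = (b, s)" by (cases l)
    have s: "s \<in> S" and u: "u \<in> lists (UNIV \<times> S)" using Cons l by auto
    have "P (word_class S R [l])"
      using gen[OF s] inv[OF _ gen[OF s]] neg[OF s] s l
      by (cases b) (auto simp: carrier_presented_group)
    moreover have "word_class S R (l # u) =
        word_class S R [l] \<otimes>\<^bsub>presented_group S R\<^esub> word_class S R u"
      using s u l by (simp add: mult_presented_group)
    ultimately show ?case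
      using mult Cons.IH u s l by (auto simp: carrier_presented_group)
  qed
  then show ?thesis using x by (auto simp: carrier_presented_group)
qed

section \<open>The nonabelian tensor square as a crossed module\<close>

text \<open>The relations of the tensor square read as conditions on a map into \<open>H\<close>;
  such maps are those that factor through a homomorphism from the tensor square.\<close>

definition crossed_pairing ::
  "'g monoid \<Rightarrow> ('h, 'm) monoid_scheme \<Rightarrow> ('g \<Rightarrow> 'g \<Rightarrow> 'h) \<Rightarrow> bool" where
  "crossed_pairing G H f \<longleftrightarrow>
     (\<forall>g\<in>carrier G. \<forall>h\<in>carrier G. f g h \<in> carrier H) \<and>
     (\<forall>g\<in>carrier G. \<forall>g'\<in>carrier G. \<forall>h\<in>carrier G.
        f (g \<otimes>\<^bsub>G\<^esub> g') h = f (conj_by G g g') (conj_by G g h) \<otimes>\<^bsub>H\<^esub> f g h) \<and>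
     (\<forall>g\<in>carrier G. \<forall>h\<in>carrier G. \<forall>h'\<in>carrier G.
        f g (h \<otimes>\<^bsub>G\<^esub> h') = f g h \<otimes>\<^bsub>H\<^esub> f (conj_by G h g) (conj_by G h h'))"

locale nonabelian_tensor_square = group G for G :: "'g monoid" (structure) +
  fixes T :: "('g \<times> 'g) word set monoid"
  assumes T_eq: "T = tensor_square G"
begin

lemma conj_by_closed [simp]:
  "x \<in> carrier G \<Longrightarrow> y \<in> carrier G \<Longrightarrow> conj_by G x y \<in> carrier G"
  by (simp add: conj_by_def)

lemma conj_by_conj_by:
  assumes "x \<in> carrier G" "y \<in> carrier G" "z \<in> carrier G"
  shows "conj_by G x (conj_by G y z) = conj_by G (x \<otimes> y) z"
  using assms by (simp add: conj_by_def word_simps)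

lemma conj_by_one [simp]: "z \<in> carrier G \<Longrightarrow> conj_by G \<one> z = z"
  by (simp add: conj_by_def)

lemma conj_by_mult:
  assumes "x \<in> carrier G" "y \<in> carrier G" "z \<in> carrier G"
  shows "conj_by G x (y \<otimes> z) = conj_by G x y \<otimes> conj_by G x z"
  using assms by (simp add: conj_by_def word_simps)

lemma conj_by_conj_by_distrib:
  assumes "x \<in> carrier G" "y \<in> carrier G" "z \<in> carrier G"
  shows "conj_by G (conj_by G x y) (conj_by G x z) = conj_by G x (conj_by G y z)"
  using assms by (simp add: conj_by_def word_simps)

lemma conj_by_mult_self: "x \<in> carrier G \<Longrightarrow> y \<in> carrier G \<Longrightarrow> conj_by G x y \<otimes> x = x \<otimes> y"
  by (simp add: conj_by_def word_simps)

lemma comm_closed [simp]: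
  "x \<in> carrier G \<Longrightarrow> y \<in> carrier G \<Longrightarrow> comm G x y \<in> carrier G"
  by (simp add: comm_def)

abbreviation S where "S \<equiv> carrier G \<times> carrier G"
abbreviation tens (infixl \<open>\<diamondop>\<close> 75) where "g \<diamondop> h \<equiv> tensor G g h"
abbreviation tmult (infixl \<open>\<cdot>\<close> 70) where "x \<cdot> y \<equiv> x \<otimes>\<^bsub>T\<^esub> y"

lemma T_presented: "T = presented_group S (tensor_relations G)"
  by (simp add: T_eq tensor_square_def)

sublocale T: group T
  by (simp add: T_presented group_presented_group)

lemma tensor_word_class: "g \<diamondop> h = word_class S (tensor_relations G) [(True, (g, h))]"
  by (simp add: tensor_def word_class_def)

lemma tensor_closed [simp]: "g \<in> carrier G \<Longrightarrow> h \<in> carrier G \<Longrightarrow> g \<diamondop> h \<in> carrier T"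
  by (simp add: tensor_word_class T_presented carrier_presented_group)

lemma tensor_mult_left:
  assumes "g \<in> carrier G" "g' \<in> carrier G" "h \<in> carrier G"
  shows "(g \<otimes> g') \<diamondop> h = conj_by G g g' \<diamondop> conj_by G g h \<cdot> g \<diamondop> h"
proof -
  have "word_eq S (tensor_relations G) [(True, (g \<otimes> g', h))]
      [(True, (conj_by G g g', conj_by G g h)), (True, (g, h))]"
    using assms by (intro word_eq.relation) (auto simp: tensor_relations_def)
  from word_class_eq[OF this] show ?thesis
    using assms by (simp add: tensor_word_class T_presented mult_presented_group)
qed

lemma tensor_mult_right:
  assumes "g \<in> carrier G" "h \<in> carrier G" "h' \<in> carrier G"
  shows "g \<diamondop> (h \<otimes> h') = g \<diamondop> h \<cdot> conj_by G h g \<diamondop> conj_by G h h'"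
proof -
  have "word_eq S (tensor_relations G) [(True, (g, h \<otimes> h'))]
      [(True, (g, h)), (True, (conj_by G h g, conj_by G h h'))]"
    using assms by (intro word_eq.relation) (auto simp: tensor_relations_def)
  from word_class_eq[OF this] show ?thesis
    using assms by (simp add: tensor_word_class T_presented mult_presented_group)
qed

lemma tensor_induct [consumes 1, case_names one tensor inv mult]:
  assumes "x \<in> carrier T"
    and "P \<one>\<^bsub>T\<^esub>"
    and "\<And>g h. g \<in> carrier G \<Longrightarrow> h \<in> carrier G \<Longrightarrow> P (g \<diamondop> h)"
    and "\<And>x. x \<in> carrier T \<Longrightarrow> P x \<Longrightarrow> P (inv\<^bsub>T\<^esub> x)"
    and "\<And>x y. x \<in> carrier T \<Longrightarrow> y \<in> carrier T \<Longrightarrow> P x \<Longrightarrow> P y \<Longrightarrow> P (x \<cdot> y)"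
  shows "P x"
proof -
  note P = assms[unfolded T_presented tensor_word_class]
  show ?thesis
    by (rule presented_group_induct[OF P(1)]) (use P(2-) in auto)
qed

lemma tensor_hom_eq:
  assumes "group H" "\<phi> \<in> hom T H" "\<psi> \<in> hom T H"
    and "\<And>g h. g \<in> carrier G \<Longrightarrow> h \<in> carrier G \<Longrightarrow> \<phi> (g \<diamondop> h) = \<psi> (g \<diamondop> h)"
    and "x \<in> carrier T"
  shows "\<phi> x = \<psi> x"
proof -
  interpret \<phi>: group_hom T H \<phi> using assms by (simp add: group_hom_def group_hom_axioms_def T.is_group)
  interpret \<psi>: group_hom T H \<psi> using assms by (simp add: group_hom_def group_hom_axioms_def T.is_group)
  show ?thesis
    using assms(5) by (induction rule: tensor_induct) (simp_all add: assms(4))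
qed

definition tensor_lift :: "('h, 'm) monoid_scheme \<Rightarrow> ('g \<Rightarrow> 'g \<Rightarrow> 'h) \<Rightarrow> ('g \<times> 'g) word set \<Rightarrow> 'h" where
  "tensor_lift H f = presented_lift H (case_prod f)"

lemma
  assumes "group H" and f: "crossed_pairing G H f"
  shows tensor_lift_hom: "tensor_lift H f \<in> hom T H"
    and tensor_lift_tensor:
      "g \<in> carrier G \<Longrightarrow> h \<in> carrier G \<Longrightarrow> tensor_lift H f (g \<diamondop> h) = f g h"
proof -
  interpret H: group H by fact
  have closed: "case_prod f \<in> S \<rightarrow> carrier H"
    using f by (auto simp: crossed_pairing_def)
  have rel: "word_value H (case_prod f) u = word_value H (case_prod f) v"
    if "(u, v) \<in> tensor_relations G" for u v
    using that f by (auto simp: tensor_relations_def word_value_def crossed_pairing_def)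
  show "tensor_lift H f \<in> hom T H"
    unfolding tensor_lift_def T_presented by (rule H.presented_lift_hom[OF closed rel])
  show "tensor_lift H f (g \<diamondop> h) = f g h" if "g \<in> carrier G" "h \<in> carrier G"
    using that f unfolding tensor_lift_def tensor_word_class
    by (subst H.presented_lift_class[OF closed rel]) (auto simp: word_value_def crossed_pairing_def)
qed

section \<open>The action of \<open>G\<close> on the tensor square\<close>

definition act :: "'g \<Rightarrow> ('g \<times> 'g) word set \<Rightarrow> ('g \<times> 'g) word set" where
  "act x = tensor_lift T (\<lambda>g h. conj_by G x g \<diamondop> conj_by G x h)"

text \<open>Conjugation by \<open>x\<close> is an automorphism of \<open>G\<close>, so it carries
  each relation to a relation of the same form.\<close>

lemma crossed_pairing_act:
  assumes "x \<in> carrier G"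
  shows "crossed_pairing G T (\<lambda>g h. conj_by G x g \<diamondop> conj_by G x h)"
  unfolding crossed_pairing_def
  using assms
  by (simp add: conj_by_mult tensor_mult_left tensor_mult_right conj_by_conj_by_distrib)

lemmas act_hom = tensor_lift_hom[OF T.is_group crossed_pairing_act, folded act_def]

lemmas act_tensor [simp] = tensor_lift_tensor[OF T.is_group crossed_pairing_act, folded act_def]

lemma act_group_hom: "x \<in> carrier G \<Longrightarrow> group_hom T T (act x)"
  by (simp add: group_hom_def group_hom_axioms_def act_hom T.is_group)

lemma act_closed [simp]: "x \<in> carrier G \<Longrightarrow> t \<in> carrier T \<Longrightarrow> act x t \<in> carrier T"
  by (rule group_hom.hom_closed[OF act_group_hom])

lemma act_mult [simp]:
  "x \<in> carrier G \<Longrightarrow> s \<in> carrier T \<Longrightarrow> t \<in> carrier T \<Longrightarrow> act x (s \<cdot> t) = act x s \<cdot> act x t"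
  by (rule group_hom.hom_mult[OF act_group_hom])

lemma act_inv [simp]:
  "x \<in> carrier G \<Longrightarrow> t \<in> carrier T \<Longrightarrow> act x (inv\<^bsub>T\<^esub> t) = inv\<^bsub>T\<^esub> act x t"
  by (rule group_hom.hom_inv[OF act_group_hom])

lemma act_one_right [simp]: "x \<in> carrier G \<Longrightarrow> act x \<one>\<^bsub>T\<^esub> = \<one>\<^bsub>T\<^esub>"
  by (rule group_hom.hom_one[OF act_group_hom])

lemma act_act:
  assumes "x \<in> carrier G" "y \<in> carrier G" "t \<in> carrier T"
  shows "act x (act y t) = act (x \<otimes> y) t"
  using assms(3) by (induction rule: tensor_induct) (simp_all add: assms(1,2) conj_by_conj_by)

lemma act_one_left [simp]: "t \<in> carrier T \<Longrightarrow> act \<one> t = t"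
  by (induction rule: tensor_induct) simp_all

section \<open>The boundary map and the Peiffer identity\<close>

lemma crossed_pairing_comm: "crossed_pairing G G (comm G)"
  unfolding crossed_pairing_def by (simp add: comm_def conj_by_def word_simps)

lemma commutator_map_eq_lift: "commutator_map G = tensor_lift G (comm G)"
proof -
  have "word_commutator G = word_value G (case_prod (comm G))"
    unfolding word_commutator_def word_value_def
    by (intro ext arg_cong[where f = "\<lambda>f. foldr f _ _"]) (auto split: prod.splits)
  then show ?thesis
    by (intro ext) (simp add: commutator_map_def tensor_lift_def presented_lift_def)
qed

abbreviation bdry (\<open>\<partial>\<close>) where "\<partial> \<equiv> commutator_map G"

lemma bdry_hom: "\<partial> \<in> hom T G"
  by (simp add: commutator_map_eq_lift tensor_lift_hom[OF is_group crossed_pairing_comm])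

lemma bdry_tensor [simp]: "g \<in> carrier G \<Longrightarrow> h \<in> carrier G \<Longrightarrow> \<partial> (g \<diamondop> h) = comm G g h"
  by (simp add: commutator_map_eq_lift tensor_lift_tensor[OF is_group crossed_pairing_comm])

sublocale bdry: group_hom T G \<partial>
  by (unfold_locales) (rule bdry_hom)

lemma bdry_act:
  assumes "x \<in> carrier G" "t \<in> carrier T"
  shows "\<partial> (act x t) = conj_by G x (\<partial> t)"
  using assms(2)
  by (induction rule: tensor_induct)
    (simp_all add: assms(1) conj_by_def comm_def word_simps)

text \<open>Both sides are obtained by expanding \<open>gg' \<otimes> hh'\<close>, in the two possible orders.\<close>

lemma tensor_exchange:
  assumes "g \<in> carrier G" "h \<in> carrier G" "t \<in> carrier T"
  shows "act (g \<otimes> h) t \<cdot> g \<diamondop> h = g \<diamondop> h \<cdot> act (h \<otimes> g) t"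
proof -
  have gen: "act (g \<otimes> h) (a \<diamondop> b) \<cdot> g \<diamondop> h = g \<diamondop> h \<cdot> act (h \<otimes> g) (a \<diamondop> b)"
    if ab: "a \<in> carrier G" "b \<in> carrier G" for a b
  proof -
    \<comment> \<open>These are the outer factors that both expansions share; cancelling them leaves
      the claim for a generator.\<close>
    let ?c = "conj_by G g a \<diamondop> conj_by G g h" and ?d = "conj_by G h g \<diamondop> conj_by G h b"
    have "(g \<otimes> a) \<diamondop> (h \<otimes> b) = ?c \<cdot> (act (g \<otimes> h) (a \<diamondop> b) \<cdot> g \<diamondop> h) \<cdot> ?d"
      using assms ab
      by (subst tensor_mult_left)
        (simp_all add: tensor_mult_right conj_by_mult conj_by_conj_by conj_by_mult_self T.m_assoc)
    moreover have "(g \<otimes> a) \<diamondop> (h \<otimes> b) = ?c \<cdot> (g \<diamondop> h \<cdot> act (h \<otimes> g) (a \<diamondop> b)) \<cdot> ?d"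
      using assms ab
      by (subst tensor_mult_right)
        (simp_all add: tensor_mult_left conj_by_mult conj_by_conj_by conj_by_mult_self T.m_assoc)
    ultimately show ?thesis
      using assms ab by simp
  qed
  \<comment> \<open>Dividing by \<open>g \<diamondop> h\<close> makes both sides homomorphisms in
    \<open>t\<close>, so agreement on the generators suffices.\<close>
  let ?f = "\<lambda>t. inv\<^bsub>T\<^esub> (g \<diamondop> h) \<cdot> act (g \<otimes> h) t \<cdot> g \<diamondop> h"
  have "?f t = act (h \<otimes> g) t"
  proof (rule tensor_hom_eq[OF T.is_group _ act_hom _ assms(3)])
    show "?f \<in> hom T T"
      by (rule homI) (simp_all add: assms T.word_simps)
    show "?f (a \<diamondop> b) = act (h \<otimes> g) (a \<diamondop> b)" if "a \<in> carrier G" "b \<in> carrier G" for a b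
      using gen[OF that] that assms by (simp add: T.word_simps del: act_tensor)
  qed (use assms in simp)
  then have "g \<diamondop> h \<cdot> ?f t = g \<diamondop> h \<cdot> act (h \<otimes> g) t" by simp
  then show ?thesis using assms by (simp add: T.word_simps)
qed

text \<open>The Peiffer identity, by which \<open>\<partial>\<close> and \<open>act\<close> form a
  crossed module. For a generator it is \<open>tensor_exchange\<close> with \<open>t\<close>
  translated by the inverse of \<open>h \<otimes> g\<close>, because
  \<open>(g \<otimes> h) \<otimes> inv (h \<otimes> g)\<close> is the commutator.\<close>

lemma tensor_conj:
  assumes "s \<in> carrier T" "t \<in> carrier T"
  shows "s \<cdot> t = act (\<partial> s) t \<cdot> s"
  using assms
proof (induction arbitrary: t rule: tensor_induct)
  case (tensor g h)
  have "inv (h \<otimes> g) \<in> carrier G" "act (inv (h \<otimes> g)) t \<in> carrier T"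
    using tensor by simp_all
  then show ?case
    using tensor_exchange[of g h "act (inv (h \<otimes> g)) t"] tensor
    by (simp add: act_act comm_def word_simps r_inv)
next
  case (inv s)
  \<comment> \<open>The preimage of \<open>t\<close> under the action of
    \<open>\<partial> s\<close>, so that the induction hypothesis for \<open>u\<close> yields
    \<open>s \<cdot> u = t \<cdot> s\<close>.\<close>
  define u where "u = act (inv (\<partial> s)) t"
  have u: "u \<in> carrier T" and "s \<cdot> u = t \<cdot> s"
    using inv by (simp_all add: u_def act_act)
  then have "t = s \<cdot> u \<cdot> inv\<^bsub>T\<^esub> s"
    using inv.hyps inv.prems by (simp add: T.inv_solve_right)
  then have "inv\<^bsub>T\<^esub> s \<cdot> t = u \<cdot> inv\<^bsub>T\<^esub> s"
    using inv.hyps u by (simp add: T.word_simps)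
  then show ?case using inv.hyps by (simp add: u_def)
next
  case (mult x y)
  let ?u = "act (\<partial> y) t"
  have "x \<cdot> y \<cdot> t = x \<cdot> ?u \<cdot> y"
    using mult.IH(2)[OF mult.prems] mult.hyps mult.prems by (simp add: T.m_assoc)
  also have "x \<cdot> ?u = act (\<partial> x) ?u \<cdot> x"
    using mult.hyps mult.prems by (intro mult.IH(1)) simp
  finally show ?case
    using mult.hyps mult.prems by (simp add: act_act T.m_assoc)
qed simp

text \<open>Restricting the codomain to the derived subgroup changes neither its unit nor,
  therefore, the kernel.\<close>

lemma carrier_J_group: "carrier (J_group G) = {x \<in> carrier T. \<partial> x = \<one>}"
  by (simp add: J_group_def kernel_def T_eq)

lemma mult_J_group: "x \<otimes>\<^bsub>J_group G\<^esub> y = x \<cdot> y"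
  by (simp add: J_group_def T_eq)

text \<open>The Peiffer identity for an element whose boundary acts trivially.\<close>

lemma J_central:
  assumes "x \<in> carrier T" "\<partial> x = \<one>" "t \<in> carrier T"
  shows "x \<cdot> t = t \<cdot> x"
  using tensor_conj[OF assms(1,3)] assms by simp

lemma group_J_group: "group (J_group G)"
proof -
  have "group_hom T (G\<lparr>carrier := derived G (carrier G)\<rparr>) \<partial> \<or> True" by simp
  have "subgroup {x \<in> carrier T. \<partial> x = \<one>} T"
    using bdry.subgroup_kernel by (simp add: kernel_def)
  moreover have "J_group G = T\<lparr>carrier := {x \<in> carrier T. \<partial> x = \<one>}\<rparr>"
    by (simp add: J_group_def kernel_def T_eq)
  ultimately show ?thesis
    by (simp add: T.subgroup_imp_group)
qed

text \<open>The Peiffer identity moves \<open>x\<close> past \<open>t\<close> at the cost of acting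
  by \<open>\<partial> t\<close>, while centrality moves it at no cost.\<close>

lemma act_J_fixed_comm:
  assumes "x \<in> carrier T" "\<partial> x = \<one>" "t \<in> carrier T"
  shows "act (\<partial> t) x = x"
proof -
  have "act (\<partial> t) x \<cdot> t = x \<cdot> t"
    using tensor_conj[OF assms(3,1)] J_central[OF assms] by simp
  then show ?thesis using assms by simp
qed

end

section \<open>Lifts of transpositions\<close>

abbreviation transp :: "'a \<Rightarrow> 'a \<Rightarrow> 'a \<Rightarrow> 'a" where
  "transp \<equiv> Transposition.transpose"

definition transpositions :: "nat \<Rightarrow> (nat \<Rightarrow> nat) set" where
  "transpositions n = {transp i j | i j. i \<in> {1..n} \<and> j \<in> {1..n} \<and> i \<noteq> j}"

lemma transposition_permutes: "u \<in> transpositions n \<Longrightarrow> u permutes {1..n}"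
  by (auto simp: transpositions_def intro: permutes_swap_id)

lemma transpositions_mono: "m \<le> n \<Longrightarrow> transpositions m \<subseteq> transpositions n"
  by (fastforce simp: transpositions_def)

lemma transpositions_Suc:
  "transpositions (Suc m) = transpositions m \<union> (\<lambda>i. transp i (Suc m)) ` {1..m}"
proof
  show "transpositions (Suc m) \<subseteq> transpositions m \<union> (\<lambda>i. transp i (Suc m)) ` {1..m}"
  proof
    fix u assume "u \<in> transpositions (Suc m)"
    then obtain i j where u: "u = transp i j" and ij: "i \<in> {1..Suc m}" "j \<in> {1..Suc m}" "i \<noteq> j"
      by (auto simp: transpositions_def)
    consider "i = Suc m" "j \<in> {1..m}" | "j = Suc m" "i \<in> {1..m}" | "i \<in> {1..m}" "j \<in> {1..m}"
      using ij by force
    then show "u \<in> transpositions m \<union> (\<lambda>i. transp i (Suc m)) ` {1..m}"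
      using u ij by cases (auto simp: transpositions_def transpose_commute)
  qed
  show "transpositions m \<union> (\<lambda>i. transp i (Suc m)) ` {1..m} \<subseteq> transpositions (Suc m)"
    by (fastforce simp: transpositions_def)
qed

lemma conj_transpose:
  assumes "bij k"
  shows "k \<circ> transp a b \<circ> inv' k = transp (k a) (k b)"
proof
  fix x
  show "(k \<circ> transp a b \<circ> inv' k) x = transp (k a) (k b) x"
    using transpose_apply_commute[OF assms, of "k a" "k b" "inv' k x"] assms
    by (simp add: bij_is_inj bij_is_surj inv_f_f surj_f_inv_f)
qed

text \<open>Modulo the central subgroup \<open>M\<close> the lifts \<open>d u\<close> satisfy the
  relations of the symmetric group on all its transpositions: each has square one, and conjugation
  permutes them as it permutes transpositions. The aim is that these relations leave nothing outside
  \<open>M\<close> in the kernel of \<open>p\<close>.\<close>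

locale transposition_lifts = group K for K :: "('k, 'm) monoid_scheme" (structure) +
  fixes n :: nat and M :: "'k set" and p :: "'k \<Rightarrow> nat \<Rightarrow> nat" and d :: "(nat \<Rightarrow> nat) \<Rightarrow> 'k"
  assumes M_subgroup: "subgroup M K"
    and M_central: "\<And>c x. c \<in> M \<Longrightarrow> x \<in> carrier K \<Longrightarrow> c \<otimes> x = x \<otimes> c"
    and p_mult: "\<And>x y. x \<in> carrier K \<Longrightarrow> y \<in> carrier K \<Longrightarrow> p (x \<otimes> y) = p x \<circ> p y"
    and p_M: "\<And>c. c \<in> M \<Longrightarrow> p c = id"
    and d_closed: "\<And>u. u \<in> transpositions n \<Longrightarrow> d u \<in> carrier K"
    and p_d: "\<And>u. u \<in> transpositions n \<Longrightarrow> p (d u) = u"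
    and d_square: "\<And>u. u \<in> transpositions n \<Longrightarrow> d u \<otimes> d u \<in> M"
    and d_conj: "\<And>u v. u \<in> transpositions n \<Longrightarrow> v \<in> transpositions n \<Longrightarrow>
      \<exists>c\<in>M. d u \<otimes> d v = c \<otimes> (d (u \<circ> v \<circ> u) \<otimes> d u)"
begin

text \<open>Filtering by the points that the transpositions may move allows an induction along the
  chain of symmetric groups. No inverses are adjoined, since squares of lifts lie in
  \<open>M\<close>.\<close>

inductive_set words :: "nat \<Rightarrow> 'k set" for m where
  base: "c \<in> M \<Longrightarrow> c \<in> words m"
| step: "x \<in> words m \<Longrightarrow> u \<in> transpositions m \<Longrightarrow> x \<otimes> d u \<in> words m"

lemma M_closed [simp]: "c \<in> M \<Longrightarrow> c \<in> carrier K"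
  using subgroup.mem_carrier[OF M_subgroup] .

lemma d_closed_le [simp]: "u \<in> transpositions m \<Longrightarrow> m \<le> n \<Longrightarrow> d u \<in> carrier K"
  using d_closed transpositions_mono by blast

lemma words_closed:
  assumes "x \<in> words m" "m \<le> n"
  shows "x \<in> carrier K"
  using assms by induction simp_all

lemma words_mult_M:
  assumes "x \<in> words m" "m \<le> n" "c \<in> M"
  shows "x \<otimes> c \<in> words m"
  using assms
proof induction
  case (base x)
  then show ?case by (simp add: words.base subgroup.m_closed[OF M_subgroup])
next
  case (step x u)
  then have "x \<otimes> d u \<otimes> c = x \<otimes> c \<otimes> d u"
    by (simp add: m_assoc M_central[of c "d u"] words_closed)
  then show ?case using step by (simp add: words.step)
qed

lemma words_mult:
  assumes "y \<in> words m" "x \<in> words m" "m \<le> n"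
  shows "x \<otimes> y \<in> words m"
  using assms
proof induction
  case (step y u)
  then have "x \<otimes> (y \<otimes> d u) = x \<otimes> y \<otimes> d u"
    by (simp add: m_assoc words_closed)
  then show ?case using step by (simp add: words.step)
qed (simp add: words_mult_M)

text \<open>As \<open>d u\<close> squares into \<open>M\<close>, its inverse is \<open>d u\<close>
  up to a factor from \<open>M\<close>.\<close>

lemma words_inv:
  assumes "x \<in> words m" "m \<le> n"
  shows "inv x \<in> words m"
  using assms
proof induction
  case (base x)
  then show ?case by (simp add: words.base subgroup.m_inv_closed[OF M_subgroup])
next
  case (step x u)
  let ?c = "d u \<otimes> d u"
  have u: "d u \<in> carrier K" and c: "?c \<in> M"
    using step transpositions_mono d_square by auto
  have "inv (d u) = inv ?c \<otimes> d u"
    using u by (simp add: word_simps)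
  moreover have "inv ?c \<otimes> d u \<in> words m"
    using c step by (intro words.step words.base subgroup.m_inv_closed[OF M_subgroup])
  ultimately have "inv (d u) \<otimes> inv x \<in> words m"
    using step by (intro words_mult) simp_all
  then show ?case
    using u step words_closed by (simp add: inv_mult_group)
qed

text \<open>The coset decomposition of the symmetric group on \<open>Suc m\<close> points over the
  one on \<open>m\<close> points, carried out for lifts. Right multiplication by any lift
  \<open>d v\<close> preserves this normal form.\<close>

lemma words_Suc_cases:
  assumes "x \<in> words (Suc m)" "Suc m \<le> n"
  shows "x \<in> words m \<or> (\<exists>w\<in>words m. \<exists>k\<in>{1..m}. x = w \<otimes> d (transp k (Suc m)))"
  using assms
proof induction
  case (base c)
  then show ?case by (simp add: words.base)
next
  case (step x v)
  have v: "v \<in> transpositions n"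
    using step transpositions_mono by blast
  consider "x \<in> words m"
    | (snoc) w k where "w \<in> words m" "k \<in> {1..m}" "x = w \<otimes> d (transp k (Suc m))"
    using step by blast
  then show ?case
  proof cases
    case 1
    then show ?thesis
      using step.hyps words.step by (auto simp: transpositions_Suc)
  next
    case snoc
    define u where "u = transp k (Suc m)"
    have um: "u \<in> transpositions (Suc m)"
      using snoc by (auto simp: u_def transpositions_Suc)
    then have u: "u \<in> transpositions n"
      using step transpositions_mono by blast
    have w: "w \<in> carrier K" "m \<le> n"
      using snoc step words_closed by simp_all
    show ?thesis
    proof (cases "v \<in> transpositions m")
      \<comment> \<open>Here \<open>d v\<close> is moved to the left past \<open>d u\<close>, which
        replaces \<open>k\<close> by \<open>v k\<close> and keeps a single last factor.\<close>
      case True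
      then have "v permutes {1..m}" by (rule transposition_permutes)
      then have vk: "v k \<in> {1..m}" and vm: "v (Suc m) = Suc m"
        using snoc by (simp_all only: permutes_in_image) (simp add: permutes_not_in)
      have inv_v: "inv' v = v" "bij v" "v \<circ> v = id"
        using True by (auto simp: transpositions_def)
      have vuv: "v \<circ> u \<circ> v = transp (v k) (Suc m)"
        using conj_transpose[OF inv_v(2), of k "Suc m"] vm inv_v by (simp add: u_def)
      then have vuv_in: "v \<circ> u \<circ> v \<in> transpositions n"
        using vk step transpositions_mono[of "Suc m" n] by (auto simp: transpositions_Suc)
      \<comment> \<open>Since conjugating twice by \<open>v\<close> returns \<open>u\<close>,
        \<open>d_conj\<close> for \<open>v\<close> and \<open>v \<circ> u \<circ> v\<close>
        exchanges the factors in the direction needed.\<close>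
      have "v \<circ> (v \<circ> u \<circ> v) \<circ> v = u"
        using inv_v(3) by (metis comp_assoc comp_id id_comp)
      then obtain c where c: "c \<in> M" and eq: "d v \<otimes> d (v \<circ> u \<circ> v) = c \<otimes> (d u \<otimes> d v)"
        using d_conj[OF v vuv_in] by auto
      have "w \<otimes> inv c \<otimes> d v \<otimes> d (v \<circ> u \<circ> v) = w \<otimes> (inv c \<otimes> (d v \<otimes> d (v \<circ> u \<circ> v)))"
        using c w u v vuv_in d_closed by (simp add: m_assoc)
      also have "\<dots> = x \<otimes> d v"
        using eq c w u v d_closed snoc by (simp add: u_def[symmetric] word_simps)
      finally have "x \<otimes> d v = w \<otimes> inv c \<otimes> d v \<otimes> d (transp (v k) (Suc m))"
        using vuv by simp
      moreover have "w \<otimes> inv c \<otimes> d v \<in> words m"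
        using True c w snoc by (intro words.step words_mult_M subgroup.m_inv_closed[OF M_subgroup])
      ultimately show ?thesis using vk by blast
    next
      case False
      then obtain i where i: "i \<in> {1..m}" "v = transp i (Suc m)"
        using step by (auto simp: transpositions_Suc)
      show ?thesis
      proof (cases "i = k")
        case True
        then have "x \<otimes> d v = w \<otimes> (d u \<otimes> d u)"
          using snoc i w u d_closed by (simp add: u_def m_assoc)
        then show ?thesis
          using words_mult_M[OF snoc(1) w(2) d_square[OF u]] by simp
      next
        \<comment> \<open>Conjugation by \<open>u\<close> turns \<open>v\<close> into
          \<open>transp i k\<close>, which does not move \<open>Suc m\<close>; the lift of
          \<open>u\<close> remains the last factor.\<close>
        case False
        have "u \<circ> v \<circ> u = transp (u i) (u (Suc m))"
          using conj_transpose[of u i "Suc m"] by (simp add: u_def i)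
        also have "\<dots> = transp i k"
          using False i snoc by (auto simp: u_def)
        finally obtain c where c: "c \<in> M" and eq: "d u \<otimes> d v = c \<otimes> (d (transp i k) \<otimes> d u)"
          using d_conj[OF u v] by auto
        have ik: "transp i k \<in> transpositions m"
          using False i snoc by (auto simp: transpositions_def)
        then have "x \<otimes> d v = w \<otimes> c \<otimes> d (transp i k) \<otimes> d u"
          using eq c w u v d_closed snoc by (simp add: u_def[symmetric] m_assoc)
        moreover have "w \<otimes> c \<otimes> d (transp i k) \<in> words m"
          using ik c w snoc by (intro words.step words_mult_M)
        ultimately show ?thesis using snoc(2) u_def by blast
      qed
    qed
  qed
qed

lemma p_words_permutes:
  assumes "x \<in> words m" "m \<le> n"
  shows "p x permutes {1..m}"
  using assms
proof induction
  case (step x u)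
  then have "u \<in> transpositions n"
    using transpositions_mono by blast
  then have "p (x \<otimes> d u) = p x \<circ> u"
    using step by (simp add: p_mult p_d d_closed words_closed)
  then show ?case
    using step transposition_permutes[of u m] by (simp add: permutes_compose del: o_apply)
qed (simp add: p_M permutes_id)

text \<open>Descent on \<open>m\<close>: if \<open>x\<close> needed a last factor
  \<open>d (transp k (Suc m))\<close>, then \<open>p x\<close> would send \<open>k\<close> to
  \<open>Suc m\<close>. Once no transpositions are left, only \<open>M\<close> remains.\<close>

lemma words_kernel:
  assumes "x \<in> words m" "m \<le> n" "p x = id"
  shows "x \<in> M"
  using assms
proof (induction m arbitrary: x)
  case 0
  from \<open>x \<in> words 0\<close> show ?case
    by cases (auto simp: transpositions_def)
next
  case (Suc m)
  have "x \<in> words m"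
  proof (rule ccontr)
    assume "x \<notin> words m"
    then obtain w k where w: "w \<in> words m" "k \<in> {1..m}" "x = w \<otimes> d (transp k (Suc m))"
      using words_Suc_cases Suc by blast
    have t: "transp k (Suc m) \<in> transpositions n"
      using w(2) Suc transpositions_mono[of "Suc m" n] by (auto simp: transpositions_Suc)
    have "p x k = p w (Suc m)"
      using w t Suc d_closed p_d by (simp add: p_mult words_closed)
    moreover have "p w (Suc m) = Suc m"
      using p_words_permutes[OF w(1)] Suc by (simp add: permutes_not_in)
    ultimately show False using Suc.prems w(2) by simp
  qed
  then show ?case using Suc by simp
qed

end

section \<open>Lifting a conjugacy class of involutions\<close>

context nonabelian_tensor_square
begin

definition semidirect :: "(('g \<times> 'g) word set \<times> 'g) monoid" where
  "semidirect = \<lparr>carrier = carrier T \<times> carrier G,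
     monoid.mult = (\<lambda>(x, g) (y, h). (x \<cdot> act g y, g \<otimes> h)), one = (\<one>\<^bsub>T\<^esub>, \<one>)\<rparr>"

lemma semidirect_simps [simp]:
  "carrier semidirect = carrier T \<times> carrier G"
  "(x, g) \<otimes>\<^bsub>semidirect\<^esub> (y, h) = (x \<cdot> act g y, g \<otimes> h)"
  "\<one>\<^bsub>semidirect\<^esub> = (\<one>\<^bsub>T\<^esub>, \<one>)"
  by (simp_all add: semidirect_def)

lemma group_semidirect: "group semidirect"
proof (rule groupI)
  fix x assume "x \<in> carrier semidirect"
  then obtain t g where x: "x = (t, g)" "t \<in> carrier T" "g \<in> carrier G" by auto
  then have "(act (inv g) (inv\<^bsub>T\<^esub> t), inv g) \<otimes>\<^bsub>semidirect\<^esub> x = \<one>\<^bsub>semidirect\<^esub>"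
    by (simp del: act_inv flip: act_mult)
  then show "\<exists>y\<in>carrier semidirect. y \<otimes>\<^bsub>semidirect\<^esub> x = \<one>\<^bsub>semidirect\<^esub>"
    by (rule bexI) (use x in simp)
qed (auto simp: T.m_assoc m_assoc act_act)

definition semidirect_bdry :: "('g \<times> 'g) word set \<times> 'g \<Rightarrow> 'g" where
  "semidirect_bdry = (\<lambda>(x, g). \<partial> x \<otimes> g)"

text \<open>Multiplicativity comes from the equivariance \<open>bdry_act\<close>.\<close>

lemma semidirect_bdry_mult:
  assumes "x \<in> carrier semidirect" "y \<in> carrier semidirect"
  shows "semidirect_bdry (x \<otimes>\<^bsub>semidirect\<^esub> y) = semidirect_bdry x \<otimes> semidirect_bdry y"
  using assms by (auto simp: semidirect_bdry_def bdry_act conj_by_def word_simps)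

lemma tensor_one_left [simp]:
  assumes "h \<in> carrier G"
  shows "\<one> \<diamondop> h = \<one>\<^bsub>T\<^esub>"
  using tensor_mult_left[of \<one> \<one> h] assms by simp

lemma tensor_one_right [simp]:
  assumes "g \<in> carrier G"
  shows "g \<diamondop> \<one> = \<one>\<^bsub>T\<^esub>"
  using tensor_mult_right[of g \<one> \<one>] assms by simp

context
  fixes s
  assumes s [simp]: "s \<in> carrier G" "s \<otimes> s = \<one>"
begin

lemma inv_involution: "inv s = s"
  by (rule inv_equality) simp_all

lemma conj_by_self: "conj_by G s s = s"
  by (simp add: conj_by_def m_assoc inv_involution)

text \<open>Expand \<open>g \<diamondop> (s \<otimes> s)\<close>, which is trivial because
  \<open>s \<otimes> s\<close> is.\<close>

lemma tensor_act_involution: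
  assumes "g \<in> carrier G"
  shows "g \<diamondop> s \<cdot> act s (g \<diamondop> s) = \<one>\<^bsub>T\<^esub>"
  using tensor_mult_right[of g s s] assms by simp

definition lift :: "'g \<Rightarrow> ('g \<times> 'g) word set \<times> 'g" where
  "lift g = (g \<diamondop> s, s)"

lemma lift_closed [simp]: "g \<in> carrier G \<Longrightarrow> lift g \<in> carrier semidirect"
  by (simp add: lift_def)

lemma lift_square: "g \<in> carrier G \<Longrightarrow> lift g \<otimes>\<^bsub>semidirect\<^esub> lift g = \<one>\<^bsub>semidirect\<^esub>"
  using tensor_act_involution by (simp add: lift_def del: act_tensor)

lemma semidirect_bdry_lift: "g \<in> carrier G \<Longrightarrow> semidirect_bdry (lift g) = conj_by G g s"
  by (simp add: semidirect_bdry_def lift_def comm_def conj_by_def word_simps inv_involution)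

text \<open>Expanding both sides of \<open>ug \<otimes> s = gs \<otimes> s\<close>, where \<open>u = gsg\<inverse>\<close>, shows that conjugation
  by the lift of \<open>g\<close> maps lifts to lifts up to the element \<open>s \<otimes> s\<close>.\<close>

lemma lift_conj:
  assumes g [simp]: "g \<in> carrier G" and h [simp]: "h \<in> carrier G"
    and fixed: "act g (s \<diamondop> s) = s \<diamondop> s"
  defines "u \<equiv> conj_by G g s"
  shows "lift (u \<otimes> h) \<otimes>\<^bsub>semidirect\<^esub> lift g = (s \<diamondop> s, \<one>) \<otimes>\<^bsub>semidirect\<^esub> (lift g \<otimes>\<^bsub>semidirect\<^esub> lift h)"
proof -
  define X where "X = g \<diamondop> s"
  define Y where "Y = act s X"
  define U where "U = u \<diamondop> s"
  define Z where "Z = act s (h \<diamondop> s)"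
  define A where "A = s \<diamondop> s"
  have u [simp]: "u \<in> carrier G" by (simp add: u_def)
  have closed [simp]: "X \<in> carrier T" "Y \<in> carrier T" "U \<in> carrier T" "Z \<in> carrier T" "A \<in> carrier T"
    by (simp_all add: X_def Y_def U_def Z_def A_def del: act_tensor)
  have bdA: "\<partial> A = \<one>" by (simp add: A_def comm_def word_simps inv_involution)
  have u_eq: "u = \<partial> X \<otimes> s"
    by (simp add: u_def X_def conj_by_def comm_def word_simps inv_involution)
  \<comment> \<open>Because \<open>u\<close> is \<open>\<partial> X\<close> times \<open>s\<close>,
    the Peiffer identity makes its action that of \<open>s\<close> followed by conjugation by
    \<open>X\<close>.\<close>
  have act_u: "act u t = X \<cdot> act s t \<cdot> inv\<^bsub>T\<^esub> X" if "t \<in> carrier T" for t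
  proof -
    have "X \<cdot> act s t = act u t \<cdot> X"
      using tensor_conj[of X "act s t"] that by (simp add: act_act u_eq)
    then show ?thesis using that by (simp add: T.inv_solve_right)
  qed
  \<comment> \<open>Tensoring both sides with \<open>s\<close> and expanding determines
    \<open>U\<close> in terms of \<open>X\<close> and \<open>A\<close>.\<close>
  have "u \<otimes> g = g \<otimes> s"
    by (simp add: u_def conj_by_def word_simps inv_involution)
  moreover have "(u \<otimes> g) \<diamondop> s = act u X \<cdot> U"
    by (simp add: tensor_mult_left X_def U_def)
  moreover have "(g \<otimes> s) \<diamondop> s = A \<cdot> X"
    using fixed by (simp add: tensor_mult_left X_def A_def)
  ultimately have "A \<cdot> X = X \<cdot> (Y \<cdot> inv\<^bsub>T\<^esub> X \<cdot> U)"
    by (simp add: act_u Y_def[symmetric] T.m_assoc)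
  then have "X \<cdot> A = X \<cdot> (Y \<cdot> inv\<^bsub>T\<^esub> X \<cdot> U)"
    using J_central[of A X] bdA by simp
  then have "A = Y \<cdot> inv\<^bsub>T\<^esub> X \<cdot> U"
    by simp
  moreover have "Y = inv\<^bsub>T\<^esub> X"
    using tensor_act_involution[OF g] T.inv_unique'[of X Y]
      by (simp add: X_def[symmetric] Y_def[symmetric] T.inv_equality T.inv_comm)
  ultimately have "U = X \<cdot> (X \<cdot> A)"
    by (simp add: T.word_simps)
  then have U: "U = X \<cdot> (A \<cdot> X)"
    using J_central[of A X] bdA by simp
  have "(u \<otimes> h) \<diamondop> s = act u (h \<diamondop> s) \<cdot> U"
    by (simp add: tensor_mult_left U_def)
  then have "(u \<otimes> h) \<diamondop> s = X \<cdot> Z \<cdot> inv\<^bsub>T\<^esub> X \<cdot> U"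
    by (simp add: act_u Z_def del: act_tensor)
  then have "(u \<otimes> h) \<diamondop> s \<cdot> Y = X \<cdot> Z \<cdot> A"
    using \<open>Y = inv\<^bsub>T\<^esub> X\<close> by (simp add: U T.word_simps)
  also have "\<dots> = A \<cdot> (X \<cdot> Z)"
    using J_central[of A "X \<cdot> Z"] bdA by simp
  finally show ?thesis
    by (simp add: lift_def X_def Y_def Z_def A_def del: act_tensor)
qed

end

end

section \<open>The tensor square of the symmetric group: generators\<close>

lemma exists_permutes_two_points:
  assumes "i \<in> A" "j \<in> A" "i \<noteq> j" "a \<in> A" "b \<in> A" "a \<noteq> b"
  obtains k where "k permutes A" "k i = a" "k j = b"
proof
  \<comment> \<open>The preimage of \<open>b\<close> under \<open>transp i a\<close>: it is where
    \<open>j\<close> must be sent first.\<close>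
  define c where "c = transp i a b"
  have c: "c \<in> A" "c \<noteq> i" "transp i a c = b"
    using assms by (auto simp: c_def Transposition.transpose_def)
  show "(transp i a \<circ> transp j c) permutes A"
    using assms c by (intro permutes_compose permutes_swap_id)
  show "(transp i a \<circ> transp j c) i = a"
    using assms c by simp
  show "(transp i a \<circ> transp j c) j = b"
    using c by simp
qed

declare sym_group_inv_equality [simp del]

locale sym_tensor_square = nonabelian_tensor_square "sym_group n" T for n T +
  assumes two_le_n: "2 \<le> n"
begin

abbreviation Sn where "Sn \<equiv> sym_group n"
abbreviation Sn_tens (infixl \<open>\<diamondop>\<close> 75) where "g \<diamondop> h \<equiv> tensor Sn g h"
abbreviation Sn_bdry (\<open>\<partial>\<close>) where "\<partial> \<equiv> commutator_map Sn"

definition s :: "nat \<Rightarrow> nat" where "s = transp 1 2"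
definition \<alpha> where "\<alpha> = s \<diamondop> s"
text \<open>For \<open>n < 4\<close> there is no transposition disjoint from \<open>s\<close>; the
  default \<open>\<one>\<close> lets \<open>M\<close> be treated uniformly.\<close>

definition \<beta> where "\<beta> = (if 4 \<le> n then transp 3 4 \<diamondop> s else \<one>\<^bsub>T\<^esub>)"
definition M where "M = {\<one>\<^bsub>T\<^esub>, \<alpha>, \<beta>, \<alpha> \<cdot> \<beta>}"

lemma comp_carrier: "x \<in> carrier Sn \<Longrightarrow> y \<in> carrier Sn \<Longrightarrow> x \<circ> y \<in> carrier Sn"
  by (simp add: sym_group_carrier permutes_compose)

lemma inv_carrier: "x \<in> carrier Sn \<Longrightarrow> inv' x \<in> carrier Sn"
  by (rule sym_group_inv_closed)

lemma transp_carrier: "i \<in> {1..n} \<Longrightarrow> j \<in> {1..n} \<Longrightarrow> transp i j \<in> carrier Sn"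
  by (simp add: sym_group_carrier permutes_swap_id)

lemmas Sn_simps = sym_group_mult sym_group_one

lemma carrier_bij: "k \<in> carrier Sn \<Longrightarrow> bij k"
  by (simp add: sym_group_carrier permutes_bij)

lemma conj_by_Sn: "k \<in> carrier Sn \<Longrightarrow> conj_by Sn k x = k \<circ> x \<circ> inv' k"
  by (simp add: conj_by_def Sn_simps sym_group_inv_equality)

lemma conj_by_transp: "k \<in> carrier Sn \<Longrightarrow> conj_by Sn k (transp i j) = transp (k i) (k j)"
  by (simp add: conj_by_Sn conj_transpose carrier_bij)

lemma s_carrier [simp]: "s \<in> carrier Sn"
  using two_le_n by (simp add: s_def transp_carrier)

lemma s_comp_s [simp]: "s \<circ> s = id"
  by (simp add: s_def)

lemma s_mult_s [simp]: "s \<otimes>\<^bsub>Sn\<^esub> s = \<one>\<^bsub>Sn\<^esub>"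
  by (simp add: Sn_simps)

lemma conj_by_s_in_transpositions:
  assumes "g \<in> carrier Sn"
  shows "conj_by Sn g s \<in> transpositions n"
proof -
  have g: "g permutes {1..n}" using assms by (simp add: sym_group_carrier)
  have "g 1 \<in> {1..n}" "g 2 \<in> {1..n}"
    using two_le_n by (simp_all only: permutes_in_image[OF g]) simp_all
  moreover have "g 1 \<noteq> g 2"
    using inj_eq[OF permutes_inj[OF g], of 1 2] by simp
  moreover have "conj_by Sn g s = transp (g 1) (g 2)"
    using assms by (simp only: s_def conj_by_transp)
  ultimately show ?thesis unfolding transpositions_def by blast
qed

lemma transposition_conj_by_s:
  assumes "u \<in> transpositions n"
  obtains g where "g \<in> carrier Sn" "conj_by Sn g s = u"
proof -
  from assms obtain i j where "u = transp i j" "i \<in> {1..n}" "j \<in> {1..n}" "i \<noteq> j"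
    by (auto simp: transpositions_def)
  moreover from this obtain k where "k permutes {1..n}" "k 1 = i" "k 2 = j"
    using exists_permutes_two_points[of 1 "{1..n}" 2 i j] two_le_n by auto
  ultimately show ?thesis
    using that[of k] by (simp add: s_def conj_by_transp sym_group_carrier)
qed

text \<open>Every permutation is a product of conjugates \<open>ksk\<inverse> = [k, s] s\<close>, and the boundary of an
  element of \<open>T\<close> acts trivially on the kernel of the boundary map.\<close>

lemma act_fixed:
  assumes c: "c \<in> carrier T" "\<partial> c = id" and fixed: "act s c = c" and "g \<in> carrier Sn"
  shows "act g c = c"
proof -
  have conj: "act (conj_by Sn k s) c = c" if k: "k \<in> carrier Sn" for k
  proof -
    have "act (comm Sn k s) c = c"
      using act_J_fixed_comm[of c "k \<diamondop> s"] c k by (simp add: Sn_simps)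
    moreover have "conj_by Sn k s = comm Sn k s \<otimes>\<^bsub>Sn\<^esub> s"
      using k by (simp add: conj_by_def comm_def word_simps)
    ultimately show ?thesis
      using c fixed k by (simp flip: act_act)
  qed
  have "g permutes {1..n}" "finite {1..n}"
    using assms by (simp_all add: sym_group_carrier)
  then show ?thesis
  proof (induction rule: permutes_induct)
    case id
    then show ?case using act_one_left[OF c(1)] by (simp add: Sn_simps id_def)
  next
    case (swap i j p)
    then have "transp i j \<in> transpositions n" by (auto simp: transpositions_def)
    then obtain k where "k \<in> carrier Sn" "conj_by Sn k s = transp i j"
      by (rule transposition_conj_by_s)
    then have "act (transp i j) c = c" "transp i j \<in> carrier Sn"
      using conj[of k] transp_carrier swap by auto
    moreover have "act (transp i j) (act p c) = act (transp i j \<circ> p) c"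
      using swap act_act[of "transp i j" p c] c transp_carrier
      by (simp only: Sn_simps sym_group_carrier)
    ultimately show ?case
      using swap.IH by (simp only:)
  qed
qed

lemma conj_by_s_disjoint:
  assumes "z \<in> carrier Sn" "z \<circ> s = s \<circ> z"
  shows "conj_by Sn z s = s" "conj_by Sn s z = z" "\<partial> (z \<diamondop> s) = id"
proof -
  have mult: "z \<otimes>\<^bsub>Sn\<^esub> s = s \<otimes>\<^bsub>Sn\<^esub> z" using assms by (simp add: Sn_simps)
  show 1: "conj_by Sn z s = s"
    using assms(1) by (simp add: conj_by_def mult word_simps)
  show "conj_by Sn s z = z"
    using assms(1) by (simp add: conj_by_def mult[symmetric] m_assoc)
  have "\<partial> (z \<diamondop> s) = conj_by Sn z s \<otimes>\<^bsub>Sn\<^esub> inv\<^bsub>Sn\<^esub> s"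
    using assms(1) by (simp add: comm_def conj_by_def)
  then show "\<partial> (z \<diamondop> s) = id"
    by (simp add: 1) (simp add: Sn_simps)
qed

text \<open>Conjugation by \<open>s\<close> fixes both \<open>z\<close> and \<open>s\<close>, and
  \<open>act_fixed\<close> extends this from \<open>s\<close> to the whole group.\<close>

lemma tensor_s_commuting_fixed:
  assumes "z \<in> carrier Sn" "z \<circ> s = s \<circ> z" "g \<in> carrier Sn"
  shows "act g (z \<diamondop> s) = z \<diamondop> s"
proof -
  have "act s (z \<diamondop> s) = z \<diamondop> s"
    by (simp only: act_tensor[OF s_carrier assms(1) s_carrier] conj_by_s_disjoint(2)[OF assms(1,2)]
        conj_by_self[OF s_carrier s_mult_s])
  then show ?thesis
    by (rule act_fixed[OF tensor_closed[OF assms(1) s_carrier] conj_by_s_disjoint(3)[OF assms(1,2)]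
          _ assms(3)])
qed

text \<open>In \<open>tensor_act_involution\<close> the second factor is fixed by the action of
  \<open>s\<close>.\<close>

lemma tensor_s_commuting_involution:
  assumes "z \<in> carrier Sn" "z \<circ> s = s \<circ> z"
  shows "z \<diamondop> s \<cdot> z \<diamondop> s = \<one>\<^bsub>T\<^esub>"
  using tensor_act_involution[OF s_carrier s_mult_s assms(1)]
  by (simp only: tensor_s_commuting_fixed[OF assms s_carrier])

lemma transp_34_commutes: "transp 3 4 \<circ> s = s \<circ> transp 3 4"
  by (auto simp: s_def fun_eq_iff Transposition.transpose_def)

lemma transp_34_carrier: "4 \<le> n \<Longrightarrow> transp 3 4 \<in> carrier Sn"
  by (simp add: transp_carrier)

lemma
  shows \<alpha>_closed [simp]: "\<alpha> \<in> carrier T"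
    and \<alpha>_bdry [simp]: "\<partial> \<alpha> = id"
    and \<alpha>_square [simp]: "\<alpha> \<cdot> \<alpha> = \<one>\<^bsub>T\<^esub>"
    and \<alpha>_fixed [simp]: "g \<in> carrier Sn \<Longrightarrow> act g \<alpha> = \<alpha>"
  unfolding \<alpha>_def
  using conj_by_s_disjoint(3)[of s] tensor_s_commuting_involution[of s] tensor_s_commuting_fixed[of s]
  by simp_all

lemma
  shows \<beta>_closed [simp]: "\<beta> \<in> carrier T"
    and \<beta>_bdry [simp]: "\<partial> \<beta> = id"
    and \<beta>_square [simp]: "\<beta> \<cdot> \<beta> = \<one>\<^bsub>T\<^esub>"
    and \<beta>_fixed [simp]: "g \<in> carrier Sn \<Longrightarrow> act g \<beta> = \<beta>"
  unfolding \<beta>_def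
  using conj_by_s_disjoint(3)[OF transp_34_carrier transp_34_commutes]
    tensor_s_commuting_involution[OF transp_34_carrier transp_34_commutes]
    tensor_s_commuting_fixed[OF transp_34_carrier transp_34_commutes] transp_34_carrier
    bdry.hom_one
  by (simp_all add: Sn_simps)

lemma J_commute: "x \<in> carrier T \<Longrightarrow> \<partial> x = id \<Longrightarrow> t \<in> carrier T \<Longrightarrow> x \<cdot> t = t \<cdot> x"
  using J_central by (simp add: Sn_simps)

lemma \<alpha>_\<beta>_commute: "\<beta> \<cdot> \<alpha> = \<alpha> \<cdot> \<beta>"
  by (rule J_commute) simp_all

lemma \<alpha>_\<alpha>_cancel [simp]: "t \<in> carrier T \<Longrightarrow> \<alpha> \<cdot> (\<alpha> \<cdot> t) = t"
  by (simp flip: T.m_assoc)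

lemma \<beta>_\<beta>_cancel [simp]: "t \<in> carrier T \<Longrightarrow> \<beta> \<cdot> (\<beta> \<cdot> t) = t"
  by (simp flip: T.m_assoc)

lemma \<beta>_\<alpha>_cancel [simp]: "\<beta> \<cdot> (\<alpha> \<cdot> \<beta>) = \<alpha>"
  by (simp add: T.m_assoc flip: \<alpha>_\<beta>_commute)

lemma M_members [simp]: "\<one>\<^bsub>T\<^esub> \<in> M" "\<alpha> \<in> M" "\<beta> \<in> M"
  by (simp_all add: M_def)

lemma M_mult: "x \<in> M \<Longrightarrow> y \<in> M \<Longrightarrow> x \<cdot> y \<in> M"
  by (auto simp: M_def T.m_assoc \<alpha>_\<beta>_commute)

lemma M_square: "x \<in> M \<Longrightarrow> x \<cdot> x = \<one>\<^bsub>T\<^esub>"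
  by (auto simp: M_def T.m_assoc)

lemma M_closed: "x \<in> M \<Longrightarrow> x \<in> carrier T"
  by (auto simp: M_def)

lemma M_bdry: "x \<in> M \<Longrightarrow> \<partial> x = id"
  using bdry.hom_one by (auto simp: M_def Sn_simps)

lemma M_act: "x \<in> M \<Longrightarrow> g \<in> carrier Sn \<Longrightarrow> act g x = x"
  by (auto simp: M_def)

text \<open>Every transposition of \<open>{3..n}\<close> is conjugate to \<open>transp 3 4\<close>
  by some \<open>k\<close> fixing 1 and 2, so its tensor with \<open>s\<close> is
  \<open>act k \<beta> = \<beta>\<close>. As \<open>M\<close> is fixed by the action, each further
  transposition contributes just a factor \<open>\<beta>\<close>.\<close>

lemma tensor_s_M_fixing:
  assumes "z permutes {3..n}"
  shows "z \<diamondop> s \<in> M"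
proof -
  have carr: "q \<in> carrier Sn" if "q permutes {3..n}" for q
    using that by (auto simp: sym_group_carrier intro: permutes_subset)
  have conj_s: "conj_by Sn q s = s" if "q permutes {3..n}" for q
    using that carr[OF that] by (simp add: s_def conj_by_transp permutes_not_in[OF that])
  show ?thesis
    using assms finite_atLeastAtMost[of 3 n]
  proof (induction rule: permutes_induct)
    case id
    then show ?case using tensor_one_left[OF s_carrier] by (simp add: Sn_simps M_def id_def)
  next
    case (swap i j q)
    then have n4: "4 \<le> n" and "3 \<in> {3..n}" "4 \<in> {3..n}" by auto
    then obtain k where k: "k permutes {3..n}" "k 3 = i" "k 4 = j"
      using exists_permutes_two_points[of 3 "{3..n}" 4 i j] swap by auto
    have "transp i j \<diamondop> s = act k \<beta>"
      using n4 k carr[OF k(1)] transp_34_carrier by (simp add: \<beta>_def conj_by_transp conj_s)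
    then have "transp i j \<diamondop> s = \<beta>"
      using carr[OF k(1)] by simp
    moreover have ij: "transp i j permutes {3..n}"
      using swap by (simp add: permutes_swap_id)
    moreover have "(transp i j \<circ> q) \<diamondop> s = act (transp i j) (q \<diamondop> s) \<cdot> transp i j \<diamondop> s"
      using tensor_mult_left[of "transp i j" q s] carr[OF ij] carr[OF swap.hyps(4)]
      by (simp add: Sn_simps)
    ultimately have "(transp i j \<circ> q) \<diamondop> s = q \<diamondop> s \<cdot> \<beta>"
      using M_act[OF swap.IH] carr[OF ij] by simp
    then show ?case
      using M_mult[OF swap.IH M_members(3)] by (simp only:)
  qed
qed

text \<open>The centraliser of \<open>s\<close> consists of the permutations fixing 1 and 2 and of
  their products with \<open>s\<close>; such a factor \<open>s\<close> contributes
  \<open>\<alpha>\<close>.\<close>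

lemma tensor_s_M_commuting:
  assumes z: "z \<in> carrier Sn" and comm: "z \<circ> s = s \<circ> z"
  shows "z \<diamondop> s \<in> M"
proof -
  have fixing: "q \<diamondop> s \<in> M" if q: "q \<in> carrier Sn" "q 1 = 1" "q 2 = 2" for q
  proof -
    have "q permutes {3..n}"
    proof (rule permutes_superset)
      show "q permutes {1..n}" using q by (simp add: sym_group_carrier)
      show "\<And>x. x \<in> {1..n} - {3..n} \<Longrightarrow> q x = x"
      proof -
        fix x assume "x \<in> {1..n} - {3..n}"
        then have "x = 1 \<or> x = 2" by auto
        then show "q x = x" using q by auto
      qed
    qed
    then show ?thesis by (rule tensor_s_M_fixing)
  qed
  have "transp (z 1) (z 2) = transp 1 2"
    using conj_by_s_disjoint(1)[OF assms] z by (simp add: s_def conj_by_transp)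
  then have "transp (z 1) (z 2) 1 = 2" by simp
  moreover have "a = 1 \<and> b = 2 \<or> a = 2 \<and> b = 1" if "transp a b 1 = (2 :: nat)" for a b
    using that by (auto simp: Transposition.transpose_def split: if_splits)
  ultimately consider "z 1 = 1" "z 2 = 2" | "z 1 = 2" "z 2 = 1" by blast
  then show ?thesis
  proof cases
    case 1
    then show ?thesis using fixing z by simp
  next
    case 2
    let ?q = "s \<circ> z"
    have q: "?q \<in> carrier Sn" "?q \<diamondop> s \<in> M"
      using fixing[of ?q] z comp_carrier[OF s_carrier z] 2 by (simp_all add: s_def)
    have "z = s \<otimes>\<^bsub>Sn\<^esub> ?q"
      by (simp add: Sn_simps flip: comp_assoc)
    then have "z \<diamondop> s = act s (?q \<diamondop> s) \<cdot> \<alpha>"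
      using tensor_mult_left[of s ?q s] q(1) by (simp add: \<alpha>_def)
    then show ?thesis
      using M_act[OF q(2)] M_mult[OF q(2), of \<alpha>] by simp
  qed
qed

text \<open>The quotient of \<open>g\<close> and \<open>h\<close> centralises \<open>s\<close>, so
  expanding \<open>h\<close> as \<open>g\<close> times this quotient gives a factor from
  \<open>M\<close>.\<close>

lemma tensor_s_eq_mod_M:
  assumes g: "g \<in> carrier Sn" and h: "h \<in> carrier Sn" and eq: "conj_by Sn g s = conj_by Sn h s"
  obtains c where "c \<in> M" "h \<diamondop> s = c \<cdot> g \<diamondop> s"
proof
  let ?z = "inv\<^bsub>Sn\<^esub> g \<otimes>\<^bsub>Sn\<^esub> h"
  have z: "?z \<in> carrier Sn" using g h by (simp)
  have "?z \<otimes>\<^bsub>Sn\<^esub> s = inv\<^bsub>Sn\<^esub> g \<otimes>\<^bsub>Sn\<^esub> (conj_by Sn h s \<otimes>\<^bsub>Sn\<^esub> h)"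
    using g h by (simp add: conj_by_mult_self m_assoc)
  also have "\<dots> = s \<otimes>\<^bsub>Sn\<^esub> ?z"
    unfolding eq[symmetric] using g h by (simp add: conj_by_def word_simps)
  finally show zM: "?z \<diamondop> s \<in> M"
    using z by (intro tensor_s_M_commuting) (simp_all add: Sn_simps)
  have "(g \<otimes>\<^bsub>Sn\<^esub> ?z) \<diamondop> s = act g (?z \<diamondop> s) \<cdot> g \<diamondop> s"
    using tensor_mult_left[OF g z s_carrier] act_tensor[OF g z s_carrier] by simp
  moreover have "g \<otimes>\<^bsub>Sn\<^esub> ?z = h"
    using g h by (simp add: word_simps)
  ultimately show "h \<diamondop> s = ?z \<diamondop> s \<cdot> g \<diamondop> s"
    using M_act[OF zM g] by simp
qed

end

section \<open>The kernel of the boundary map for the symmetric group\<close>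

context sym_tensor_square
begin

text \<open>An arbitrary choice; by \<open>lift_mod_M\<close> below, another choice changes the lift
  of \<open>u\<close> only by a factor from \<open>M\<close>.\<close>

definition rep :: "(nat \<Rightarrow> nat) \<Rightarrow> nat \<Rightarrow> nat" where
  "rep u = (SOME g. g \<in> carrier Sn \<and> conj_by Sn g s = u)"

lemma rep:
  assumes "u \<in> transpositions n"
  shows "rep u \<in> carrier Sn" "conj_by Sn (rep u) s = u"
proof -
  have "\<exists>g. g \<in> carrier Sn \<and> conj_by Sn g s = u"
    using transposition_conj_by_s[OF assms] by metis
  from someI_ex[OF this] show "rep u \<in> carrier Sn" "conj_by Sn (rep u) s = u"
    by (simp_all add: rep_def)
qed

lemma transpositions_carrier: "u \<in> transpositions n \<Longrightarrow> u \<in> carrier Sn"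
  by (simp only: sym_group_carrier transposition_permutes)

lemma transposition_inverse:
  assumes "u \<in> transpositions n"
  shows "inv\<^bsub>Sn\<^esub> u = u"
  using assms transpositions_carrier[OF assms]
  by (auto simp: transpositions_def sym_group_inv_equality)

lemma lift_eq: "lift s g = (g \<diamondop> s, s)"
  by (simp add: lift_def)

lemma M_nonempty: "M \<noteq> {}"
  by (simp add: M_def)

text \<open>Elements of \<open>M\<close> are central in \<open>T\<close>, being killed by
  \<open>\<partial>\<close>, and are fixed by the action of \<open>Sn\<close>.\<close>

lemma semidirect_M_central:
  assumes "c \<in> M" "x \<in> carrier semidirect"
  shows "(c, \<one>\<^bsub>Sn\<^esub>) \<otimes>\<^bsub>semidirect\<^esub> x = x \<otimes>\<^bsub>semidirect\<^esub> (c, \<one>\<^bsub>Sn\<^esub>)"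
  using assms J_commute M_closed M_bdry M_act by auto

lemma lift_mod_M:
  assumes g: "g \<in> carrier Sn" and h: "h \<in> carrier Sn" and eq: "conj_by Sn g s = conj_by Sn h s"
  obtains c where "c \<in> M" "lift s h = (c, \<one>\<^bsub>Sn\<^esub>) \<otimes>\<^bsub>semidirect\<^esub> lift s g"
proof -
  obtain c where "c \<in> M" "h \<diamondop> s = c \<cdot> g \<diamondop> s"
    using tensor_s_eq_mod_M[OF assms] .
  then show ?thesis
    using that g by (simp add: lift_eq del: act_tensor)
qed

text \<open>\<open>lift_conj\<close> gives the relation with the lift of \<open>u\<close> times
  \<open>rep v\<close>. This element also conjugates \<open>s\<close> to
  \<open>u \<circ> v \<circ> u\<close>, so its lift differs from the chosen one by a factor from
  \<open>M\<close>.\<close>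

lemma lift_rep_conj:
  assumes u: "u \<in> transpositions n" and v: "v \<in> transpositions n"
  shows "\<exists>c\<in>M \<times> {\<one>\<^bsub>Sn\<^esub>}. lift s (rep u) \<otimes>\<^bsub>semidirect\<^esub> lift s (rep v) =
    c \<otimes>\<^bsub>semidirect\<^esub> (lift s (rep (u \<circ> v \<circ> u)) \<otimes>\<^bsub>semidirect\<^esub> lift s (rep u))"
proof -
  interpret K: group semidirect by (rule group_semidirect)
  \<comment> \<open>Solves the relation of \<open>lift_conj\<close> for the product of the two
    lifts, using that the central factor is its own inverse.\<close>
  have move: "y \<otimes>\<^bsub>semidirect\<^esub> z = (a \<otimes>\<^bsub>semidirect\<^esub> c) \<otimes>\<^bsub>semidirect\<^esub> (w \<otimes>\<^bsub>semidirect\<^esub> y)"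
    if "c \<otimes>\<^bsub>semidirect\<^esub> w \<otimes>\<^bsub>semidirect\<^esub> y = a \<otimes>\<^bsub>semidirect\<^esub> (y \<otimes>\<^bsub>semidirect\<^esub> z)"
      and "a \<otimes>\<^bsub>semidirect\<^esub> a = \<one>\<^bsub>semidirect\<^esub>"
      and closed: "a \<in> carrier semidirect" "c \<in> carrier semidirect" "w \<in> carrier semidirect"
        "y \<in> carrier semidirect" "z \<in> carrier semidirect"
    for a c w y z
  proof -
    have "(a \<otimes>\<^bsub>semidirect\<^esub> c) \<otimes>\<^bsub>semidirect\<^esub> (w \<otimes>\<^bsub>semidirect\<^esub> y) =
        a \<otimes>\<^bsub>semidirect\<^esub> (c \<otimes>\<^bsub>semidirect\<^esub> w \<otimes>\<^bsub>semidirect\<^esub> y)"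
      using closed by (simp only: K.m_assoc K.m_closed)
    also have "\<dots> = (a \<otimes>\<^bsub>semidirect\<^esub> a) \<otimes>\<^bsub>semidirect\<^esub> (y \<otimes>\<^bsub>semidirect\<^esub> z)"
      using closed by (simp only: that(1) K.m_assoc K.m_closed)
    finally show ?thesis
      using closed by (simp only: that(2) K.l_one K.m_closed)
  qed
  note rep_uv = rep[OF u] rep[OF v]
  have uS: "u \<in> carrier Sn"
    using u by (simp add: transpositions_carrier)
  let ?w = "u \<circ> v \<circ> u" and ?h = "u \<otimes>\<^bsub>Sn\<^esub> rep v"
  have h: "?h \<in> carrier Sn" using uS rep_uv by simp
  have "conj_by Sn ?h s = conj_by Sn u (conj_by Sn (rep v) s)"
    by (rule conj_by_conj_by[OF uS rep_uv(3) s_carrier, symmetric])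
  also have "\<dots> = ?w"
    using rep_uv transposition_inverse[OF u] by (simp add: conj_by_def Sn_simps)
  finally have conj_h: "conj_by Sn ?h s = ?w" .
  then have w: "?w \<in> transpositions n"
    using conj_by_s_in_transpositions[OF h] by simp
  note rep_w = rep[OF w]
  obtain c where c: "c \<in> M"
    and lift_h: "lift s ?h = (c, \<one>\<^bsub>Sn\<^esub>) \<otimes>\<^bsub>semidirect\<^esub> lift s (rep ?w)"
    by (rule lift_mod_M[OF rep_w(1) h]) (use conj_h rep_w in simp_all)
  have "act (rep u) (s \<diamondop> s) = s \<diamondop> s"
    using \<alpha>_fixed[OF rep_uv(1)] by (simp add: \<alpha>_def)
  from lift_conj[OF s_carrier s_mult_s rep_uv(1) rep_uv(3) this]
  have main: "lift s ?h \<otimes>\<^bsub>semidirect\<^esub> lift s (rep u) =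
      (\<alpha>, \<one>\<^bsub>Sn\<^esub>) \<otimes>\<^bsub>semidirect\<^esub> (lift s (rep u) \<otimes>\<^bsub>semidirect\<^esub> lift s (rep v))"
    by (simp only: rep_uv(2) \<alpha>_def)
  have lifts: "lift s (rep u) \<in> carrier semidirect" "lift s (rep v) \<in> carrier semidirect"
      "lift s (rep ?w) \<in> carrier semidirect"
    using rep_uv rep_w lift_closed[OF s_carrier s_mult_s] by blast+
  have closed: "(\<alpha>, \<one>\<^bsub>Sn\<^esub>) \<in> carrier semidirect" "(c, \<one>\<^bsub>Sn\<^esub>) \<in> carrier semidirect"
    using c M_closed by simp_all
  have square: "(\<alpha>, \<one>\<^bsub>Sn\<^esub>) \<otimes>\<^bsub>semidirect\<^esub> (\<alpha>, \<one>\<^bsub>Sn\<^esub>) = \<one>\<^bsub>semidirect\<^esub>"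
    by simp
  have "lift s (rep u) \<otimes>\<^bsub>semidirect\<^esub> lift s (rep v) =
      ((\<alpha>, \<one>\<^bsub>Sn\<^esub>) \<otimes>\<^bsub>semidirect\<^esub> (c, \<one>\<^bsub>Sn\<^esub>)) \<otimes>\<^bsub>semidirect\<^esub>
      (lift s (rep ?w) \<otimes>\<^bsub>semidirect\<^esub> lift s (rep u))"
    by (rule move[OF main[unfolded lift_h] square closed lifts(3,1,2)])
  moreover have "(\<alpha>, \<one>\<^bsub>Sn\<^esub>) \<otimes>\<^bsub>semidirect\<^esub> (c, \<one>\<^bsub>Sn\<^esub>) \<in> M \<times> {\<one>\<^bsub>Sn\<^esub>}"
    using c M_closed M_mult[OF M_members(2) c] by simp
  ultimately show ?thesis by (rule bexI)
qed

sublocale lifts: transposition_lifts semidirect n "M \<times> {\<one>\<^bsub>Sn\<^esub>}" semidirect_bdry "\<lambda>u. lift s (rep u)"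
proof (intro transposition_lifts.intro transposition_lifts_axioms.intro)
  interpret K: group semidirect by (rule group_semidirect)
  show "group semidirect" by (rule group_semidirect)
  show "subgroup (M \<times> {\<one>\<^bsub>Sn\<^esub>}) semidirect"
  proof (rule K.subgroupI)
    show "inv\<^bsub>semidirect\<^esub> x \<in> M \<times> {\<one>\<^bsub>Sn\<^esub>}" if x: "x \<in> M \<times> {\<one>\<^bsub>Sn\<^esub>}" for x
    proof -
      have "x \<otimes>\<^bsub>semidirect\<^esub> x = \<one>\<^bsub>semidirect\<^esub>" "x \<in> carrier semidirect"
        using x by (auto simp: M_closed M_square)
      then have "inv\<^bsub>semidirect\<^esub> x = x" by (intro K.inv_equality)
      then show ?thesis using x by simp
    qed
  qed (auto simp: M_closed M_mult M_nonempty)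
  show "c \<otimes>\<^bsub>semidirect\<^esub> x = x \<otimes>\<^bsub>semidirect\<^esub> c"
    if "c \<in> M \<times> {\<one>\<^bsub>Sn\<^esub>}" "x \<in> carrier semidirect" for c x
    using that semidirect_M_central by blast
  show "semidirect_bdry (x \<otimes>\<^bsub>semidirect\<^esub> y) = semidirect_bdry x \<circ> semidirect_bdry y"
    if "x \<in> carrier semidirect" "y \<in> carrier semidirect" for x y
    using semidirect_bdry_mult[OF that] by (simp only: Sn_simps)
  show "semidirect_bdry c = id" if "c \<in> M \<times> {\<one>\<^bsub>Sn\<^esub>}" for c
    using that by (auto simp: semidirect_bdry_def M_bdry Sn_simps)
  show "lift s (rep u) \<in> carrier semidirect" if "u \<in> transpositions n" for u
    using rep[OF that] by (intro lift_closed) simp_all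
  show "semidirect_bdry (lift s (rep u)) = u" if "u \<in> transpositions n" for u
    using rep[OF that] semidirect_bdry_lift[OF s_carrier s_mult_s] by simp
  show "lift s (rep u) \<otimes>\<^bsub>semidirect\<^esub> lift s (rep u) \<in> M \<times> {\<one>\<^bsub>Sn\<^esub>}" if "u \<in> transpositions n" for u
    using rep[OF that] by (simp only: lift_square[OF s_carrier s_mult_s]) simp
qed (rule lift_rep_conj)

section \<open>The products of lifts exhaust the tensor square\<close>

abbreviation words where "words \<equiv> lifts.words n"

lemma lift_in_words:
  assumes "g \<in> carrier Sn"
  shows "lift s g \<in> words"
proof -
  have u: "conj_by Sn g s \<in> transpositions n"
    using assms by (rule conj_by_s_in_transpositions)
  obtain c where "c \<in> M" "lift s g = (c, \<one>\<^bsub>Sn\<^esub>) \<otimes>\<^bsub>semidirect\<^esub> lift s (rep (conj_by Sn g s))"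
    by (rule lift_mod_M[OF rep(1)[OF u] assms rep(2)[OF u]])
  then show ?thesis
    using u by (simp only:) (intro lifts.words.step lifts.words.base, simp_all)
qed

definition word_tensors where "word_tensors = {x \<in> carrier T. (x, \<one>\<^bsub>Sn\<^esub>) \<in> words}"

lemma word_tensors_mult: "x \<in> word_tensors \<Longrightarrow> y \<in> word_tensors \<Longrightarrow> x \<cdot> y \<in> word_tensors"
  using lifts.words_mult[of "(y, \<one>\<^bsub>Sn\<^esub>)" n "(x, \<one>\<^bsub>Sn\<^esub>)"] by (simp add: word_tensors_def)

lemma word_tensors_inv:
  assumes "x \<in> word_tensors"
  shows "inv\<^bsub>T\<^esub> x \<in> word_tensors"
proof -
  have x: "x \<in> carrier T" "(x, \<one>\<^bsub>Sn\<^esub>) \<in> words" using assms by (simp_all add: word_tensors_def)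
  have "inv\<^bsub>semidirect\<^esub> (x, \<one>\<^bsub>Sn\<^esub>) = (inv\<^bsub>T\<^esub> x, \<one>\<^bsub>Sn\<^esub>)"
    using x by (intro lifts.inv_equality) simp_all
  then show ?thesis
    using lifts.words_inv[OF x(2)] x by (simp add: word_tensors_def)
qed

text \<open>The lift of the identity is \<open>s\<close> with trivial tensor part, so multiplying by
  it cancels the second component.\<close>

lemma tensor_s_in_word_tensors:
  assumes g: "g \<in> carrier Sn"
  shows "g \<diamondop> s \<in> word_tensors"
proof -
  have "lift s g \<otimes>\<^bsub>semidirect\<^esub> lift s \<one>\<^bsub>Sn\<^esub> = (g \<diamondop> s, \<one>\<^bsub>Sn\<^esub>)"
    using g by (simp add: lift_eq del: act_tensor)
  moreover have "lift s g \<otimes>\<^bsub>semidirect\<^esub> lift s \<one>\<^bsub>Sn\<^esub> \<in> words"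
    using g by (intro lifts.words_mult lift_in_words) simp_all
  ultimately show ?thesis using g by (simp add: word_tensors_def)
qed

text \<open>With \<open>k = rep u\<close> and \<open>h\<close> the conjugate of \<open>g\<close> by
  the inverse of \<open>k\<close>, expanding \<open>k \<otimes> h\<close> against \<open>s\<close>
  gives \<open>g \<diamondop> u\<close> times \<open>k \<diamondop> s\<close>.\<close>

lemma tensor_transposition_in_word_tensors:
  assumes g: "g \<in> carrier Sn" and u: "u \<in> transpositions n"
  shows "g \<diamondop> u \<in> word_tensors"
proof -
  note k = rep[OF u]
  define h where "h = conj_by Sn (inv\<^bsub>Sn\<^esub> rep u) g"
  have h: "h \<in> carrier Sn" "conj_by Sn (rep u) h = g"
    using g k by (simp_all add: h_def conj_by_conj_by)
  have "(rep u \<otimes>\<^bsub>Sn\<^esub> h) \<diamondop> s = g \<diamondop> u \<cdot> rep u \<diamondop> s"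
    using tensor_mult_left[OF k(1) h(1) s_carrier] k h by simp
  then have "g \<diamondop> u = (rep u \<otimes>\<^bsub>Sn\<^esub> h) \<diamondop> s \<cdot> inv\<^bsub>T\<^esub> (rep u \<diamondop> s)"
    using g k h transpositions_carrier[OF u] by (simp add: T.inv_solve_right)
  then show ?thesis
    using k h by (simp only:) (intro word_tensors_mult word_tensors_inv tensor_s_in_word_tensors m_closed)
qed

text \<open>Write \<open>h\<close> as a product of transpositions and split them off by the second
  tensor relation; their conjugates are again transpositions.\<close>

lemma tensor_in_word_tensors:
  assumes h: "h \<in> carrier Sn" and g: "g \<in> carrier Sn"
  shows "g \<diamondop> h \<in> word_tensors"
proof -
  have one: "\<one>\<^bsub>T\<^esub> \<in> word_tensors"
    using tensor_s_in_word_tensors[of "\<one>\<^bsub>Sn\<^esub>"] by simp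
  have "finite {1..n}" "h permutes {1..n}"
    using h by (simp_all add: sym_group_carrier)
  then show ?thesis
  proof (induction rule: permutes_rev_induct)
    case id
    then show ?case
      using tensor_one_right[OF g] one by (simp only: Sn_simps)
  next
    case (swap i j q)
    have q: "q \<in> carrier Sn" using swap.hyps(4) by (simp add: sym_group_carrier)
    have u: "transp i j \<in> transpositions n" using swap.hyps by (auto simp: transpositions_def)
    have "conj_by Sn q (transp i j) = conj_by Sn (q \<otimes>\<^bsub>Sn\<^esub> rep (transp i j)) s"
      using rep[OF u] q conj_by_conj_by[of q "rep (transp i j)" s] by simp
    then have "conj_by Sn q (transp i j) \<in> transpositions n"
      using rep[OF u] q conj_by_s_in_transpositions[of "q \<otimes>\<^bsub>Sn\<^esub> rep (transp i j)"] by simp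
    then have "g \<diamondop> q \<cdot> conj_by Sn q g \<diamondop> conj_by Sn q (transp i j) \<in> word_tensors"
      by (intro word_tensors_mult[OF swap.IH tensor_transposition_in_word_tensors] conj_by_closed q g)
    then show ?case
      using tensor_mult_right[OF g q transpositions_carrier[OF u]] by (simp only: Sn_simps)
  qed
qed

lemma word_tensors_eq: "word_tensors = carrier T"
proof
  show "carrier T \<subseteq> word_tensors"
  proof
    fix x assume "x \<in> carrier T"
    then show "x \<in> word_tensors"
    proof (induction rule: tensor_induct)
      case one
      then show ?case using tensor_s_in_word_tensors[of "\<one>\<^bsub>Sn\<^esub>"] by simp
    qed (simp_all add: tensor_in_word_tensors word_tensors_inv word_tensors_mult)
  qed
qed (auto simp: word_tensors_def)

text \<open>Every element of \<open>T\<close> is, inside the semidirect product, a product of lifts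
  up to \<open>M\<close>, so \<open>words_kernel\<close> applies.\<close>

theorem kernel_bdry: "x \<in> carrier T \<Longrightarrow> \<partial> x = id \<Longrightarrow> x \<in> M"
proof -
  assume x: "x \<in> carrier T" "\<partial> x = id"
  then have "(x, \<one>\<^bsub>Sn\<^esub>) \<in> words" using word_tensors_eq by (auto simp: word_tensors_def)
  moreover have "semidirect_bdry (x, \<one>\<^bsub>Sn\<^esub>) = id"
    using x by (simp add: semidirect_bdry_def Sn_simps)
  ultimately have "(x, \<one>\<^bsub>Sn\<^esub>) \<in> M \<times> {\<one>\<^bsub>Sn\<^esub>}"
    by (intro lifts.words_kernel[OF _ order.refl])
  then show "x \<in> M" by simp
qed

corollary carrier_J_eq_M: "carrier (J_group Sn) = M"
  using kernel_bdry M_closed M_bdry by (auto simp: carrier_J_group Sn_simps)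

end

section \<open>Central extensions and crossed pairings\<close>

locale central_extension = G?: group G + E: group E
  for G :: "'g monoid" (structure) and E :: "'e monoid" +
  fixes q
  assumes q_hom: "q \<in> hom E G"
    and q_surj: "q ` carrier E = carrier G"
    and q_kernel_central: "\<And>k x. k \<in> carrier E \<Longrightarrow> q k = \<one> \<Longrightarrow> x \<in> carrier E \<Longrightarrow>
      k \<otimes>\<^bsub>E\<^esub> x = x \<otimes>\<^bsub>E\<^esub> k"
begin

sublocale q: group_hom E G q
  by unfold_locales (rule q_hom)

lemma inv_comm_ext:
  assumes "x \<in> carrier E" "y \<in> carrier E"
  shows "inv\<^bsub>E\<^esub> (comm E x y) = comm E y x"
  using assms by (simp add: comm_def E.word_simps)

text \<open>Two lifts of the same element differ by a central factor \<open>k\<close>, which cancels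
  in the commutator.\<close>

lemma comm_ext_cong_left:
  assumes x: "x \<in> carrier E" "x' \<in> carrier E" "q x = q x'" and y: "y \<in> carrier E"
  shows "comm E x y = comm E x' y"
proof -
  define k where "k = x \<otimes>\<^bsub>E\<^esub> inv\<^bsub>E\<^esub> x'"
  have k: "k \<in> carrier E" "q k = \<one>" and xk: "x = k \<otimes>\<^bsub>E\<^esub> x'"
    using x by (simp_all add: k_def E.word_simps)
  let ?z = "x' \<otimes>\<^bsub>E\<^esub> y \<otimes>\<^bsub>E\<^esub> inv\<^bsub>E\<^esub> x'"
  have "comm E x y = k \<otimes>\<^bsub>E\<^esub> ?z \<otimes>\<^bsub>E\<^esub> inv\<^bsub>E\<^esub> k \<otimes>\<^bsub>E\<^esub> inv\<^bsub>E\<^esub> y"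
    using x y k by (simp add: comm_def xk E.word_simps)
  also have "k \<otimes>\<^bsub>E\<^esub> ?z = ?z \<otimes>\<^bsub>E\<^esub> k"
    using x y k by (intro q_kernel_central) simp_all
  also have "?z \<otimes>\<^bsub>E\<^esub> k \<otimes>\<^bsub>E\<^esub> inv\<^bsub>E\<^esub> k \<otimes>\<^bsub>E\<^esub> inv\<^bsub>E\<^esub> y = comm E x' y"
    using x y k by (simp add: comm_def E.word_simps)
  finally show ?thesis .
qed

lemma comm_ext_cong:
  assumes "x \<in> carrier E" "x' \<in> carrier E" "q x = q x'"
    and "y \<in> carrier E" "y' \<in> carrier E" "q y = q y'"
  shows "comm E x y = comm E x' y'"
proof -
  have "comm E x y = inv\<^bsub>E\<^esub> (comm E y x)"
    using assms by (simp add: inv_comm_ext)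
  also have "\<dots> = inv\<^bsub>E\<^esub> (comm E y' x)"
    using comm_ext_cong_left[of y y' x] assms by simp
  also have "\<dots> = comm E x' y'"
    using comm_ext_cong_left[of x x' y'] assms by (simp add: inv_comm_ext)
  finally show ?thesis .
qed

text \<open>\<open>inv_into\<close> picks arbitrary preimages; \<open>comm_ext_cong\<close> makes
  the value independent of them.\<close>

definition lift_comm :: "'g \<Rightarrow> 'g \<Rightarrow> 'e" where
  "lift_comm g h = comm E (inv_into (carrier E) q g) (inv_into (carrier E) q h)"

lemma lift_comm_q:
  assumes "x \<in> carrier E" "y \<in> carrier E"
  shows "lift_comm (q x) (q y) = comm E x y"
  unfolding lift_comm_def
  using assms by (intro comm_ext_cong) (simp_all add: inv_into_into f_inv_into_f)

text \<open>After all arguments are written as images under \<open>q\<close>, the conditions become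
  the usual commutator identities in \<open>E\<close>.\<close>

lemma crossed_pairing_lift_comm: "crossed_pairing G E lift_comm"
proof -
  have closed: "comm E x y \<in> carrier E" if "x \<in> carrier E" "y \<in> carrier E" for x y
    using that by (simp add: comm_def)
  have conj: "conj_by G (q x) (q y) = q (conj_by E x y)" "conj_by E x y \<in> carrier E"
    if "x \<in> carrier E" "y \<in> carrier E" for x y
    using that by (simp_all add: conj_by_def)
  have mult: "q x \<otimes> q y = q (x \<otimes>\<^bsub>E\<^esub> y)" if "x \<in> carrier E" "y \<in> carrier E" for x y
    using that by simp
  show ?thesis
    unfolding crossed_pairing_def q_surj[symmetric]
    by (auto simp: mult conj lift_comm_q closed simp del: q.hom_mult)
      (simp_all add: comm_def conj_by_def E.word_simps)
qed

end

section \<open>A central extension of the symmetric group by Clifford operators\<close>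

text \<open>The generator \<open>e\<^sub>i\<close> of the Clifford algebra acts on the functions on sets of indices, by
  exterior multiplication by or contraction with \<open>i\<close>.\<close>

definition cliff :: "nat \<Rightarrow> (nat set \<Rightarrow> real) \<Rightarrow> nat set \<Rightarrow> real" where
  "cliff i f A = (- 1) ^ card (A \<inter> {..<i}) * f (if i \<in> A then A - {i} else insert i A)"

lemma cliff_diff: "cliff i (\<lambda>A. f A - g A) = (\<lambda>A. cliff i f A - cliff i g A)"
  by (auto simp: cliff_def fun_eq_iff algebra_simps)

text \<open>Inserting or removing \<open>i\<close> does not affect the elements below
  \<open>i\<close>, so the same sign occurs twice.\<close>

lemma cliff_square: "cliff i (cliff i f) = f"
proof
  fix A
  let ?B = "if i \<in> A then A - {i} else insert i A"
  have "?B \<inter> {..<i} = A \<inter> {..<i}" by auto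
  moreover have "(if i \<in> ?B then ?B - {i} else insert i ?B) = A" by auto
  ultimately show "cliff i (cliff i f) A = f A"
    unfolding cliff_def by (simp flip: power_add mult.assoc)
qed

text \<open>Flipping the smaller index \<open>i\<close> changes the number of elements below
  \<open>j\<close> by one, whereas flipping \<open>j\<close> leaves those below \<open>i\<close>
  alone.\<close>

lemma cliff_anticommute_less:
  assumes "i < j"
  shows "cliff j (cliff i f) = (\<lambda>A. - cliff i (cliff j f) A)"
proof
  fix A
  define flip where "flip k B = (if k \<in> B then B - {k} else insert k B)" for k :: nat and B
  have cliff: "cliff k g B = (- 1) ^ card (B \<inter> {..<k}) * g (flip k B)" for k g B
    by (simp add: cliff_def flip_def)
  have flips: "flip i (flip j A) = flip j (flip i A)"
    using assms by (auto simp: flip_def)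
  have "flip j A \<inter> {..<i} = A \<inter> {..<i}"
    using assms by (auto simp: flip_def)
  moreover have "(- 1 :: real) ^ card (flip i A \<inter> {..<j}) = - ((- 1) ^ card (A \<inter> {..<j}))"
  proof (cases "i \<in> A")
    case True
    then have "A \<inter> {..<j} = insert i (flip i A \<inter> {..<j})" "i \<notin> flip i A \<inter> {..<j}"
      using assms by (auto simp: flip_def)
    then show ?thesis by simp
  next
    case False
    then have "flip i A \<inter> {..<j} = insert i (A \<inter> {..<j})" "i \<notin> A \<inter> {..<j}"
      using assms by (auto simp: flip_def)
    then show ?thesis by simp
  qed
  ultimately show "cliff j (cliff i f) A = - cliff i (cliff j f) A"
    by (simp add: cliff flips)
qed

lemma cliff_anticommute:
  assumes "i \<noteq> j"
  shows "cliff j (cliff i f) A = - cliff i (cliff j f) A"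
  using assms cliff_anticommute_less[of i j f] cliff_anticommute_less[of j i f]
  by (cases "i < j") simp_all

text \<open>The Clifford vector \<open>e_i - e_j\<close>, which lifts the transposition of
  \<open>i\<close> and \<open>j\<close>. It is not normalised: its square is 2.\<close>

definition cliff_swap :: "nat \<Rightarrow> nat \<Rightarrow> (nat set \<Rightarrow> real) \<Rightarrow> nat set \<Rightarrow> real" where
  "cliff_swap i j f A = cliff i f A - cliff j f A"

lemma cliff_cliff_swap: "cliff k (cliff_swap i j f) A = cliff k (cliff i f) A - cliff k (cliff j f) A"
proof -
  have "cliff_swap i j f = (\<lambda>A. cliff i f A - cliff j f A)"
    by (simp add: cliff_swap_def fun_eq_iff)
  then show ?thesis by (simp add: cliff_diff)
qed

lemma cliff_swap_square:
  assumes "i \<noteq> j"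
  shows "cliff_swap i j (cliff_swap i j f) = (\<lambda>A. 2 * f A)"
proof
  fix A
  show "cliff_swap i j (cliff_swap i j f) A = 2 * f A"
    using cliff_anticommute[OF assms, of f A]
    by (simp add: cliff_swap_def[of i j "cliff_swap i j f"] cliff_cliff_swap cliff_square)
qed

text \<open>Expand both products; every generator in one vector anticommutes with every generator in
  the other.\<close>

lemma cliff_swap_disjoint:
  assumes "{i, j} \<inter> {k, l} = {}"
  shows "cliff_swap k l (cliff_swap i j f) A = - cliff_swap i j (cliff_swap k l f) A"
  using assms cliff_anticommute[of i k f A] cliff_anticommute[of i l f A]
    cliff_anticommute[of j k f A] cliff_anticommute[of j l f A]
  by (simp add: cliff_swap_def[of _ _ "cliff_swap _ _ f"] cliff_cliff_swap)

text \<open>Conjugation by a Clifford vector is minus the reflection along it, and the reflection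
  along \<open>e_i - e_j\<close> interchanges \<open>e_i\<close> and \<open>e_j\<close>.\<close>

lemma cliff_swap_cliff:
  assumes "i \<noteq> j"
  shows "cliff_swap i j (cliff k f) A = - cliff (transp i j k) (cliff_swap i j f) A"
proof -
  consider "k = i" | "k = j" | "k \<noteq> i" "k \<noteq> j" by blast
  then show ?thesis
    using assms cliff_anticommute[of i k f A] cliff_anticommute[of j k f A]
    unfolding cliff_swap_def[of i j "cliff k f"] cliff_cliff_swap
    by cases (simp_all add: cliff_square)
qed

lemma bij_cliff_swap:
  assumes "i \<noteq> j"
  shows "bij (cliff_swap i j)"
proof (rule o_bij)
  have half: "cliff_swap i j (\<lambda>A. f A / 2) = (\<lambda>A. cliff_swap i j f A / 2)" for f
    by (auto simp: cliff_swap_def cliff_def fun_eq_iff diff_divide_distrib)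
  let ?g = "\<lambda>f. cliff_swap i j (\<lambda>A. f A / 2)"
  show "?g \<circ> cliff_swap i j = id" "cliff_swap i j \<circ> ?g = id"
    by (simp_all add: fun_eq_iff half cliff_swap_square[OF assms])
qed

text \<open>Additivity is phrased with differences, which yields preservation of zero and of
  negation at once, hence compatibility with signs.\<close>

definition additive_op :: "((nat set \<Rightarrow> real) \<Rightarrow> nat set \<Rightarrow> real) \<Rightarrow> bool" where
  "additive_op x \<longleftrightarrow> (\<forall>f g. x (\<lambda>A. f A - g A) = (\<lambda>A. x f A - x g A))"

lemma additive_minus:
  assumes "additive_op x"
  shows "x (\<lambda>A. - f A) = (\<lambda>A. - x f A)"
proof -
  have "x (\<lambda>A. 0) = (\<lambda>A. 0)"
    using assms[unfolded additive_op_def, rule_format, of "\<lambda>_. 0" "\<lambda>_. 0"] by simp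
  then show ?thesis
    using assms[unfolded additive_op_def, rule_format, of "\<lambda>_. 0" f] by simp
qed

lemma additive_sign:
  assumes "additive_op x"
  shows "x (\<lambda>A. of_int (sign \<sigma>) * f A) = (\<lambda>A. of_int (sign \<sigma>) * x f A)"
  using additive_minus[OF assms, of f] by (cases \<sigma> rule: sign_cases) simp_all

definition cliff_commute :: "((nat set \<Rightarrow> real) \<Rightarrow> nat set \<Rightarrow> real) \<Rightarrow> bool" where
  "cliff_commute y \<longleftrightarrow> additive_op y \<and> (\<forall>i f. y (cliff i f) = cliff i (y f))"

definition pin_elements :: "nat \<Rightarrow> ((nat \<Rightarrow> nat) \<times> ((nat set \<Rightarrow> real) \<Rightarrow> nat set \<Rightarrow> real)) set" where
  "pin_elements n = {(\<sigma>, x). \<sigma> permutes {1..n} \<and> bij x \<and> additive_op x \<and>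
     (\<forall>i f. x (cliff i f) = (\<lambda>A. of_int (sign \<sigma>) * cliff (\<sigma> i) (x f) A)) \<and>
     (\<forall>y. cliff_commute y \<longrightarrow> x \<circ> y = y \<circ> x)}"

text \<open>The last condition in \<open>pin_elements\<close>, a substitute for membership in the Clifford algebra,
  makes the kernel of the projection to the symmetric group central.\<close>

definition pin_group :: "nat \<Rightarrow> ((nat \<Rightarrow> nat) \<times> ((nat set \<Rightarrow> real) \<Rightarrow> nat set \<Rightarrow> real)) monoid" where
  "pin_group n = \<lparr>carrier = pin_elements n,
     monoid.mult = (\<lambda>(\<sigma>, x) (\<tau>, y). (\<sigma> \<circ> \<tau>, x \<circ> y)), one = (id, id)\<rparr>"

lemma pin_elements_comp:
  assumes "(\<sigma>, x) \<in> pin_elements n" "(\<tau>, y) \<in> pin_elements n"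
  shows "(\<sigma> \<circ> \<tau>, x \<circ> y) \<in> pin_elements n"
proof -
  note x = assms(1)[unfolded pin_elements_def, simplified]
  note y = assms(2)[unfolded pin_elements_def, simplified]
  have "permutation \<sigma>" "permutation \<tau>"
    using x y by (auto simp: permutation_permutes)
  then have sign: "sign (\<sigma> \<circ> \<tau>) = sign \<tau> * sign \<sigma>"
    by (simp add: sign_compose)
  have "x (y (cliff i f)) = (\<lambda>A. of_int (sign (\<sigma> \<circ> \<tau>)) * cliff (\<sigma> (\<tau> i)) (x (y f)) A)" for i f
  proof -
    have "y (cliff i f) = (\<lambda>A. of_int (sign \<tau>) * cliff (\<tau> i) (y f) A)" using y by blast
    then have "x (y (cliff i f)) = (\<lambda>A. of_int (sign \<tau>) * x (cliff (\<tau> i) (y f)) A)"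
      using additive_sign[of x \<tau> "cliff (\<tau> i) (y f)"] x by (simp only:)
    moreover have "x (cliff (\<tau> i) (y f)) = (\<lambda>A. of_int (sign \<sigma>) * cliff (\<sigma> (\<tau> i)) (x (y f)) A)"
      using x by blast
    ultimately show ?thesis by (simp add: sign mult.assoc)
  qed
  moreover have "x \<circ> y \<circ> z = z \<circ> (x \<circ> y)" if "cliff_commute z" for z
  proof -
    have "x \<circ> z = z \<circ> x" "y \<circ> z = z \<circ> y" using x y that by blast+
    then show ?thesis by (metis comp_assoc)
  qed
  moreover have "additive_op (x \<circ> y)" using x y by (simp add: additive_op_def)
  ultimately show ?thesis
    using x y unfolding pin_elements_def by (simp add: permutes_compose bij_comp)
qed

lemma pin_elements_inv:
  assumes "(\<sigma>, x) \<in> pin_elements n"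
  shows "(inv' \<sigma>, inv' x) \<in> pin_elements n"
proof -
  note x = assms[unfolded pin_elements_def, simplified]
  have inj: "inj x" and surj: "surj x" using x by (auto simp: bij_def)
  have eqI: "inv' x f = g" if "f = x g" for f g
    using that inj by (simp add: inv_f_f)
  have \<sigma>: "permutation \<sigma>" "bij \<sigma>" using x by (auto simp: permutation_permutes permutes_bij)
  have "additive_op (inv' x)"
    unfolding additive_op_def
  proof (intro allI eqI)
    fix f g
    show "(\<lambda>A. f A - g A) = x (\<lambda>A. inv' x f A - inv' x g A)"
      using x surj unfolding additive_op_def by (simp add: surj_f_inv_f)
  qed
  moreover have "inv' x (cliff i f) = (\<lambda>A. of_int (sign (inv' \<sigma>)) * cliff (inv' \<sigma> i) (inv' x f) A)" for i f
  proof (rule eqI)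
    have "x (cliff (inv' \<sigma> i) (inv' x f)) = (\<lambda>A. of_int (sign \<sigma>) * cliff (\<sigma> (inv' \<sigma> i)) (x (inv' x f)) A)"
      using x by blast
    also have "\<dots> = (\<lambda>A. of_int (sign \<sigma>) * cliff i f A)"
      using surj \<sigma> by (simp add: surj_f_inv_f bij_is_surj)
    finally show "cliff i f = x (\<lambda>A. of_int (sign (inv' \<sigma>)) * cliff (inv' \<sigma> i) (inv' x f) A)"
      using x \<sigma> by (simp add: additive_sign sign_inverse flip: mult.assoc of_int_mult)
  qed
  moreover have "inv' x \<circ> y = y \<circ> inv' x" if "cliff_commute y" for y
  proof
    fix f
    have "x \<circ> y = y \<circ> x" using x that by blast
    then have "y f = x (y (inv' x f))"
      using surj by (metis comp_apply surj_f_inv_f)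
    then show "(inv' x \<circ> y) f = (y \<circ> inv' x) f" by (simp add: eqI)
  qed
  ultimately show ?thesis
    using x unfolding pin_elements_def by (simp add: permutes_inv bij_imp_bij_inv)
qed

lemma pin_elements_id: "(id, id) \<in> pin_elements n"
  by (simp add: pin_elements_def permutes_id additive_op_def)

lemma group_pin_group: "group (pin_group n)"
proof (rule groupI)
  fix e assume "e \<in> carrier (pin_group n)"
  then obtain \<sigma> x where e: "e = (\<sigma>, x)" "(\<sigma>, x) \<in> pin_elements n"
    by (cases e) (auto simp: pin_group_def)
  then have "inv' \<sigma> \<circ> \<sigma> = id" "inv' x \<circ> x = id"
    by (auto simp: pin_elements_def permutes_inv_o bij_def)
  then show "\<exists>y\<in>carrier (pin_group n). y \<otimes>\<^bsub>pin_group n\<^esub> e = \<one>\<^bsub>pin_group n\<^esub>"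
    using pin_elements_inv[OF e(2)] e(1) by (auto simp: pin_group_def intro!: bexI)
qed (auto simp: pin_group_def pin_elements_id pin_elements_comp comp_assoc)

text \<open>The minus sign in \<open>cliff_swap_cliff\<close> is the sign of the transposition. An
  additive operator commuting with all generators commutes with their differences.\<close>

lemma cliff_swap_pin_elements:
  assumes "i \<in> {1..n}" "j \<in> {1..n}" "i \<noteq> j"
  shows "(transp i j, cliff_swap i j) \<in> pin_elements n"
proof -
  have "cliff_swap i j (cliff k f) =
      (\<lambda>A. of_int (sign (transp i j)) * cliff (transp i j k) (cliff_swap i j f) A)" for k f
    using cliff_swap_cliff[OF assms(3)] assms(3) by (simp add: fun_eq_iff sign_swap_id)
  moreover have "additive_op (cliff_swap i j)"
    by (simp add: additive_op_def cliff_swap_def cliff_diff fun_eq_iff)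
  moreover have "cliff_swap i j \<circ> y = y \<circ> cliff_swap i j" if "cliff_commute y" for y
  proof
    fix f
    have swap: "cliff_swap i j g = (\<lambda>A. cliff i g A - cliff j g A)" for g
      by (simp add: cliff_swap_def fun_eq_iff)
    show "(cliff_swap i j \<circ> y) f = (y \<circ> cliff_swap i j) f"
      using that by (simp add: swap cliff_commute_def additive_op_def)
  qed
  ultimately show ?thesis
    using assms bij_cliff_swap unfolding pin_elements_def by (simp add: permutes_swap_id)
qed

text \<open>Surjectivity holds because transpositions generate. Over the identity the twisted
  relation says that the operator commutes with all generators, so the last condition in
  \<open>pin_elements\<close> makes it commute with every other operator of the group.\<close>

lemma central_extension_pin_group: "central_extension (sym_group n) (pin_group n) fst"
proof (intro central_extension.intro central_extension_axioms.intro sym_group_is_group group_pin_group)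
  show "fst \<in> hom (pin_group n) (sym_group n)"
    by (auto simp: hom_def pin_group_def sym_group_def pin_elements_def)
  show "fst ` carrier (pin_group n) = carrier (sym_group n)"
  proof
    show "carrier (sym_group n) \<subseteq> fst ` carrier (pin_group n)"
    proof
      fix \<sigma> assume "\<sigma> \<in> carrier (sym_group n)"
      then have "\<sigma> permutes {1..n}" "finite {1..n}" by (simp_all add: sym_group_carrier)
      then have "\<exists>x. (\<sigma>, x) \<in> pin_elements n"
      proof (induction rule: permutes_induct)
        case id
        then show ?case using pin_elements_id by blast
      next
        case (swap i j p)
        then show ?case
          using pin_elements_comp[OF cliff_swap_pin_elements] by blast
      qed
      then show "\<sigma> \<in> fst ` carrier (pin_group n)" by (force simp: pin_group_def)
    qed
  qed (auto simp: pin_group_def pin_elements_def sym_group_carrier)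
  fix k e assume k: "k \<in> carrier (pin_group n)" "fst k = \<one>\<^bsub>sym_group n\<^esub>"
    and e: "e \<in> carrier (pin_group n)"
  obtain \<sigma> x where ex: "e = (\<sigma>, x)" by (cases e)
  obtain y where ky: "k = (id, y)" using k by (cases k) (auto simp: sym_group_one)
  have "cliff_commute y"
    using k by (auto simp: ky pin_group_def pin_elements_def cliff_commute_def)
  then have "x \<circ> y = y \<circ> x"
    using e by (auto simp: ex pin_group_def pin_elements_def)
  then show "k \<otimes>\<^bsub>pin_group n\<^esub> e = e \<otimes>\<^bsub>pin_group n\<^esub> k"
    by (simp add: ex ky pin_group_def)
qed

text \<open>The two operators anticommute. If they also commuted, their product would be zero, yet
  it is bijective.\<close>

lemma comm_pin_group_disjoint:
  assumes "i \<in> {1..n}" "j \<in> {1..n}" "k \<in> {1..n}" "l \<in> {1..n}" "i \<noteq> j" "k \<noteq> l" "{i, j} \<inter> {k, l} = {}"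
  shows "comm (pin_group n) (transp i j, cliff_swap i j) (transp k l, cliff_swap k l) \<noteq> \<one>\<^bsub>pin_group n\<^esub>"
proof
  interpret E: group "pin_group n" by (rule group_pin_group)
  let ?x = "(transp i j, cliff_swap i j)" and ?y = "(transp k l, cliff_swap k l)"
  have closed: "?x \<in> carrier (pin_group n)" "?y \<in> carrier (pin_group n)"
    using assms cliff_swap_pin_elements by (simp_all add: pin_group_def)
  assume "comm (pin_group n) ?x ?y = \<one>\<^bsub>pin_group n\<^esub>"
  then have "comm (pin_group n) ?x ?y \<otimes>\<^bsub>pin_group n\<^esub> (?y \<otimes>\<^bsub>pin_group n\<^esub> ?x) = ?y \<otimes>\<^bsub>pin_group n\<^esub> ?x"
    using closed by simp
  then have "?x \<otimes>\<^bsub>pin_group n\<^esub> ?y = ?y \<otimes>\<^bsub>pin_group n\<^esub> ?x"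
    using closed by (simp add: comm_def E.word_simps)
  then have comm: "cliff_swap i j \<circ> cliff_swap k l = cliff_swap k l \<circ> cliff_swap i j"
    by (simp add: pin_group_def)
  have "cliff_swap k l (cliff_swap i j f) = (\<lambda>A. 0)" for f
  proof
    fix A
    have "cliff_swap i j (cliff_swap k l f) A = cliff_swap k l (cliff_swap i j f) A"
      using comm by (simp add: fun_eq_iff)
    then show "cliff_swap k l (cliff_swap i j f) A = 0"
      using cliff_swap_disjoint[OF assms(7), of f A] by simp
  qed
  moreover have "bij (cliff_swap k l \<circ> cliff_swap i j)"
    using assms bij_cliff_swap by (intro bij_comp) simp_all
  ultimately have "inj (\<lambda>f :: nat set \<Rightarrow> real. \<lambda>A :: nat set. 0 :: real)"
    by (simp add: bij_def comp_def)
  from injD[OF this, of "\<lambda>_. 0" "\<lambda>_. 1"] show False by (simp add: fun_eq_iff)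
qed

section \<open>The groups \<open>J(S\<^sub>n)\<close> and \<open>J(S\<^sub>n)/\<Delta>(S\<^sub>n)\<close>\<close>

definition sign_pairing :: "(nat \<Rightarrow> nat) \<Rightarrow> (nat \<Rightarrow> nat) \<Rightarrow> int" where
  "sign_pairing g h = (if evenperm g \<or> evenperm h then 0 else 1)"

lemma carrier_integer_mod_2: "carrier (integer_mod_group 2) = {0, 1}"
  by (auto simp: carrier_integer_mod_group)

context sym_tensor_square
begin

section \<open>The two homomorphisms that detect \<open>\<alpha>\<close> and
  \<open>\<beta>\<close>\<close>

lemma evenperm_comp_carrier:
  "g \<in> carrier Sn \<Longrightarrow> h \<in> carrier Sn \<Longrightarrow> evenperm (g \<circ> h) \<longleftrightarrow> evenperm g = evenperm h"
  by (intro evenperm_comp sym_group_carrier')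

lemma evenperm_conj:
  assumes "g \<in> carrier Sn" "h \<in> carrier Sn"
  shows "evenperm (conj_by Sn g h) = evenperm h"
  using assms evenperm_inv[OF sym_group_carrier'[OF assms(1)]]
  by (auto simp: conj_by_Sn evenperm_comp_carrier comp_carrier inv_carrier)

text \<open>Parity is additive and invariant under conjugation, so the product of parities is
  bilinear and the conjugations in the conditions have no effect.\<close>

lemma crossed_pairing_sign: "crossed_pairing Sn (integer_mod_group 2) sign_pairing"
  unfolding crossed_pairing_def
  by (auto simp: sign_pairing_def evenperm_conj evenperm_comp_carrier Sn_simps carrier_integer_mod_2)

sublocale pin: central_extension Sn "pin_group n" fst
  by (rule central_extension_pin_group)

definition sign_map where "sign_map = tensor_lift (integer_mod_group 2) sign_pairing"
definition pin_map where "pin_map = tensor_lift (pin_group n) pin.lift_comm"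

lemma sign_map_tensor: "g \<in> carrier Sn \<Longrightarrow> h \<in> carrier Sn \<Longrightarrow> sign_map (g \<diamondop> h) = sign_pairing g h"
  unfolding sign_map_def
  by (rule tensor_lift_tensor[OF group_integer_mod_group crossed_pairing_sign])

lemma pin_map_tensor:
  "g \<in> carrier Sn \<Longrightarrow> h \<in> carrier Sn \<Longrightarrow> pin_map (g \<diamondop> h) = pin.lift_comm g h"
  unfolding pin_map_def
  by (rule tensor_lift_tensor[OF group_pin_group pin.crossed_pairing_lift_comm])

sublocale sign_map: group_hom T "integer_mod_group 2" sign_map
  unfolding sign_map_def
  by (intro group_hom.intro group_hom_axioms.intro T.is_group group_integer_mod_group
      tensor_lift_hom[OF group_integer_mod_group crossed_pairing_sign])

sublocale pin_map: group_hom T "pin_group n" pin_map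
  unfolding pin_map_def
  by (intro group_hom.intro group_hom_axioms.intro T.is_group group_pin_group
      tensor_lift_hom[OF group_pin_group pin.crossed_pairing_lift_comm])

text \<open>In terms of lifts this is the product of a commutator and its inverse.\<close>

lemma pin_map_swap:
  assumes "x \<in> carrier Sn" "y \<in> carrier Sn"
  shows "pin_map (x \<diamondop> y \<cdot> y \<diamondop> x) = \<one>\<^bsub>pin_group n\<^esub>"
proof -
  obtain a b where ab: "a \<in> carrier (pin_group n)" "x = fst a" "b \<in> carrier (pin_group n)" "y = fst b"
    using assms unfolding pin.q_surj[symmetric] by blast
  have "pin_map (x \<diamondop> y \<cdot> y \<diamondop> x) = comm (pin_group n) a b \<otimes>\<^bsub>pin_group n\<^esub> comm (pin_group n) b a"
    using assms ab by (simp add: pin_map_tensor pin.lift_comm_q)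
  also have "\<dots> = \<one>\<^bsub>pin_group n\<^esub>"
    using ab by (simp add: comm_def pin.E.word_simps)
  finally show ?thesis .
qed

lemma sign_map_\<alpha>: "sign_map \<alpha> = 1"
  by (simp add: \<alpha>_def sign_map_tensor sign_pairing_def) (simp add: s_def evenperm_swap)

lemma \<alpha>_neq_one: "\<alpha> \<noteq> \<one>\<^bsub>T\<^esub>"
  using sign_map_\<alpha> sign_map.hom_one by auto

text \<open>The value is the commutator of a lift of \<open>s\<close> with itself.\<close>

lemma pin_map_\<alpha>: "pin_map \<alpha> = \<one>\<^bsub>pin_group n\<^esub>"
proof -
  obtain a where a: "a \<in> carrier (pin_group n)" "s = fst a"
    using s_carrier unfolding pin.q_surj[symmetric] by blast
  have "pin_map \<alpha> = comm (pin_group n) a a"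
    unfolding \<alpha>_def pin_map_tensor[OF s_carrier s_carrier]
    using pin.lift_comm_q[OF a(1) a(1)] by (simp only: a(2))
  then show ?thesis using a by (simp add: comm_def pin.E.word_simps)
qed

lemma pin_map_\<beta>:
  assumes "4 \<le> n"
  shows "pin_map \<beta> \<noteq> \<one>\<^bsub>pin_group n\<^esub>"
proof -
  have closed: "(transp 3 4, cliff_swap 3 4) \<in> carrier (pin_group n)"
      "(transp 1 2, cliff_swap 1 2) \<in> carrier (pin_group n)"
    using assms cliff_swap_pin_elements by (simp_all add: pin_group_def)
  have "pin_map \<beta> = comm (pin_group n) (transp 3 4, cliff_swap 3 4) (transp 1 2, cliff_swap 1 2)"
    using pin.lift_comm_q[OF closed] assms transp_34_carrier
    by (simp add: \<beta>_def pin_map_tensor) (simp add: s_def)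
  then show ?thesis
    using comm_pin_group_disjoint[of 3 n 4 1 2] assms by simp
qed

lemma \<beta>_trivial: "\<not> 4 \<le> n \<Longrightarrow> \<beta> = \<one>\<^bsub>T\<^esub>"
  by (simp add: \<beta>_def)

text \<open>The two maps together separate the elements of \<open>M\<close>: \<open>pin_map\<close>
  kills \<alpha> but not a nontrivial \<beta>, and \<open>sign_map\<close> then rules out
  \<alpha>.\<close>

lemma M_trivial:
  assumes "z \<in> M" "sign_map z = 0" "pin_map z = \<one>\<^bsub>pin_group n\<^esub>"
  shows "z = \<one>\<^bsub>T\<^esub>"
proof -
  have eq: "pin_map (\<alpha> \<cdot> \<beta>) = pin_map \<beta>"
    by (simp add: pin_map_\<alpha>)
  consider "z = \<one>\<^bsub>T\<^esub>" | "z = \<alpha>" | "z = \<beta>" | "z = \<alpha> \<cdot> \<beta>"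
    using assms(1) by (auto simp: M_def)
  then show ?thesis
  proof cases
    case 2
    then show ?thesis using assms(2) sign_map_\<alpha> by simp
  next
    case 3
    then show ?thesis using assms(3) pin_map_\<beta> \<beta>_trivial by metis
  next
    case 4
    then have "\<not> 4 \<le> n" using assms(3) pin_map_\<beta> eq by metis
    then have "z = \<alpha>" using 4 \<beta>_trivial by simp
    then show ?thesis using assms(2) sign_map_\<alpha> by simp
  qed simp
qed

text \<open>The element lies in \<open>M\<close> by \<open>kernel_bdry\<close>. The sign pairing is
  symmetric, so \<open>sign_map\<close> gives an even value, and \<open>pin_map\<close> is trivial
  on it too.\<close>

lemma tensor_swap_trivial:
  assumes "x \<in> carrier Sn" "y \<in> carrier Sn"
  shows "x \<diamondop> y \<cdot> y \<diamondop> x = \<one>\<^bsub>T\<^esub>"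
proof -
  let ?z = "x \<diamondop> y \<cdot> y \<diamondop> x"
  have "\<partial> ?z = comm Sn x y \<otimes>\<^bsub>Sn\<^esub> comm Sn y x"
    using assms by simp
  also have "\<dots> = \<one>\<^bsub>Sn\<^esub>"
    using assms by (simp add: comm_def word_simps)
  finally have "?z \<in> M"
    using assms by (intro kernel_bdry) (simp_all add: Sn_simps)
  moreover have "sign_map ?z = 0"
    using assms by (auto simp: sign_map_tensor sign_pairing_def)
  moreover have "pin_map ?z = \<one>\<^bsub>pin_group n\<^esub>"
    using assms by (rule pin_map_swap)
  ultimately show ?thesis by (intro M_trivial)
qed

lemma one_J_group: "\<one>\<^bsub>J_group Sn\<^esub> = \<one>\<^bsub>T\<^esub>"
  by (simp add: J_group_def T_eq)

lemma Delta_trivial: "Delta_subgroup Sn = {\<one>\<^bsub>J_group Sn\<^esub>}"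
proof -
  interpret J: group "J_group Sn" by (rule group_J_group)
  have "Delta_subgroup Sn \<subseteq> {\<one>\<^bsub>J_group Sn\<^esub>}"
    unfolding Delta_subgroup_def T_eq[symmetric]
    by (rule J.generate_subgroup_incl[OF _ J.triv_subgroup])
      (auto simp: tensor_swap_trivial one_J_group)
  moreover have "\<one>\<^bsub>J_group Sn\<^esub> \<in> Delta_subgroup Sn"
    unfolding Delta_subgroup_def by (rule generate.one)
  ultimately show ?thesis by blast
qed

lemma J_Mod_Delta_iso: "J_group Sn Mod Delta_subgroup Sn \<cong> J_group Sn"
  unfolding Delta_trivial by (rule is_isoI[OF group.trivial_factor_iso[OF group_J_group]])

section \<open>The isomorphism types\<close>

lemma J_iso_Z2:
  assumes "\<not> 4 \<le> n"
  shows "J_group Sn \<cong> integer_mod_group 2"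
proof -
  define \<theta> where "\<theta> i = (if i = 0 then \<one>\<^bsub>T\<^esub> else \<alpha>)" for i :: int
  have M: "M = {\<one>\<^bsub>T\<^esub>, \<alpha>}"
    using \<beta>_trivial[OF assms] by (auto simp: M_def)
  have "\<theta> \<in> hom (integer_mod_group 2) (J_group Sn)"
    by (rule homI) (auto simp: \<theta>_def carrier_integer_mod_2 carrier_J_eq_M mult_J_group)
  moreover have "bij_betw \<theta> (carrier (integer_mod_group 2)) (carrier (J_group Sn))"
    using \<alpha>_neq_one by (auto simp: \<theta>_def carrier_integer_mod_2 carrier_J_eq_M M bij_betw_def inj_on_def)
  ultimately have "integer_mod_group 2 \<cong> J_group Sn"
    by (auto simp: is_iso_def iso_def)
  then show ?thesis by (rule group.iso_sym[OF group_integer_mod_group])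
qed

lemma J_iso_Z2_Z2:
  assumes n: "4 \<le> n"
  shows "J_group Sn \<cong> integer_mod_group 2 \<times>\<times> integer_mod_group 2"
proof -
  define \<theta> where "\<theta> = (\<lambda>(i :: int, j :: int). (if i = 0 then \<one>\<^bsub>T\<^esub> else \<alpha>) \<cdot> (if j = 0 then \<one>\<^bsub>T\<^esub> else \<beta>))"
  let ?Z = "integer_mod_group 2 \<times>\<times> integer_mod_group 2"
  have carrier: "carrier ?Z = {(0, 0), (0, 1), (1, 0), (1, 1)}"
    by (auto simp: DirProd_def carrier_integer_mod_2)
  have "\<beta> \<noteq> \<one>\<^bsub>T\<^esub>" "\<alpha> \<noteq> \<beta>"
    using pin_map_\<beta>[OF n] pin_map_\<alpha> pin_map.hom_one by auto
  moreover have "\<alpha> \<cdot> \<beta> \<noteq> \<one>\<^bsub>T\<^esub>"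
  proof
    assume *: "\<alpha> \<cdot> \<beta> = \<one>\<^bsub>T\<^esub>"
    have "\<beta> = \<alpha> \<cdot> (\<alpha> \<cdot> \<beta>)" by simp
    also have "\<dots> = \<alpha>" by (simp only: * T.r_one \<alpha>_closed)
    finally show False using \<open>\<alpha> \<noteq> \<beta>\<close> by simp
  qed
  moreover have "\<alpha> \<cdot> \<beta> \<noteq> \<alpha>" "\<alpha> \<cdot> \<beta> \<noteq> \<beta>"
    using \<alpha>_neq_one \<open>\<beta> \<noteq> \<one>\<^bsub>T\<^esub>\<close> by simp_all
  ultimately have "bij_betw \<theta> (carrier ?Z) (carrier (J_group Sn))"
    using \<alpha>_neq_one unfolding carrier carrier_J_eq_M M_def bij_betw_def inj_on_def
    by (auto simp: \<theta>_def)
  moreover have "\<theta> \<in> hom ?Z (J_group Sn)"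
  proof (rule homI)
    show "\<theta> p \<in> carrier (J_group Sn)" if "p \<in> carrier ?Z" for p
      using that unfolding carrier by (auto simp: \<theta>_def carrier_J_eq_M M_mult)
    show "\<theta> (p \<otimes>\<^bsub>?Z\<^esub> r) = \<theta> p \<otimes>\<^bsub>J_group Sn\<^esub> \<theta> r" if "p \<in> carrier ?Z" "r \<in> carrier ?Z" for p r
      using that unfolding carrier
      by (auto simp: \<theta>_def mult_J_group T.m_assoc \<alpha>_\<beta>_commute)
  qed
  ultimately have "?Z \<cong> J_group Sn"
    by (auto simp: is_iso_def iso_def)
  then show ?thesis
    by (rule group.iso_sym[OF DirProd_group[OF group_integer_mod_group group_integer_mod_group]])
qed

end

text \<open>The symmetric groups with \<open>n < 2\<close> are trivial and so have trivial
  \<open>J_group\<close>, which is why \<open>n\<close> is at least 2. The algebraic statements are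
  unconditional; the homotopy groups follow from them through the Brown-Loday isomorphisms.\<close>

theorem proposition5p2:
  fixes n :: nat
  assumes "2 \<le> n"
  shows
    "((if 4 \<le> n then J_group (sym_group n) \<cong> integer_mod_group 2 \<times>\<times> integer_mod_group 2
       else J_group (sym_group n) \<cong> integer_mod_group 2) \<and>
      (if 4 \<le> n then J_group (sym_group n) Mod Delta_subgroup (sym_group n)
                      \<cong> integer_mod_group 2 \<times>\<times> integer_mod_group 2
       else J_group (sym_group n) Mod Delta_subgroup (sym_group n) \<cong> integer_mod_group 2)) \<and>
     (Brown_Loday TYPE(nat \<Rightarrow> nat) TYPE('a) \<longrightarrow>
       (\<forall>(X :: 'a topology) x0. is_K_G_1 (sym_group n) X x0 \<longrightarrow>
         (if 4 \<le> n then pi3_suspension X \<cong> integer_mod_group 2 \<times>\<times> integer_mod_group 2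
          else pi3_suspension X \<cong> integer_mod_group 2) \<and>
         (if 4 \<le> n then stable_pi2 X \<cong> integer_mod_group 2 \<times>\<times> integer_mod_group 2
          else stable_pi2 X \<cong> integer_mod_group 2)))"
proof -
  interpret sym_tensor_square n "tensor_square (sym_group n)"
    using assms
    by (intro sym_tensor_square.intro sym_tensor_square_axioms.intro nonabelian_tensor_square.intro
        nonabelian_tensor_square_axioms.intro sym_group_is_group) simp_all
  show ?thesis
  proof (intro conjI impI allI)
    show "if 4 \<le> n then J_group Sn \<cong> integer_mod_group 2 \<times>\<times> integer_mod_group 2
        else J_group Sn \<cong> integer_mod_group 2"
      using J_iso_Z2 J_iso_Z2_Z2 by simp
    show "if 4 \<le> n then J_group Sn Mod Delta_subgroup Sn \<cong> integer_mod_group 2 \<times>\<times> integer_mod_group 2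
        else J_group Sn Mod Delta_subgroup Sn \<cong> integer_mod_group 2"
      by (simp add: iso_trans[OF J_Mod_Delta_iso] J_iso_Z2 J_iso_Z2_Z2)
    fix X :: "'a topology" and x0
    assume "Brown_Loday TYPE(nat \<Rightarrow> nat) TYPE('a)" "is_K_G_1 Sn X x0"
    then have "pi3_suspension X \<cong> J_group Sn" "stable_pi2 X \<cong> J_group Sn Mod Delta_subgroup Sn"
      unfolding Brown_Loday_def using sym_group_is_group by blast+
    then have pi3: "pi3_suspension X \<cong> J_group Sn" and stable: "stable_pi2 X \<cong> J_group Sn"
      using iso_trans J_Mod_Delta_iso by blast+
    show "if 4 \<le> n then pi3_suspension X \<cong> integer_mod_group 2 \<times>\<times> integer_mod_group 2
        else pi3_suspension X \<cong> integer_mod_group 2"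
      by (simp add: iso_trans[OF pi3] J_iso_Z2 J_iso_Z2_Z2)
    show "if 4 \<le> n then stable_pi2 X \<cong> integer_mod_group 2 \<times>\<times> integer_mod_group 2
        else stable_pi2 X \<cong> integer_mod_group 2"
      by (simp add: iso_trans[OF stable] J_iso_Z2 J_iso_Z2_Z2)
  qed
qed

end
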